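(* Assume that Assumption 1 (stated in the context) holds. Let $X\in\mathcal{B}_N$, let $F$ be a minimal factorization of $X$, and let $e$ be an edge of $X$. If $\#U(e)>0$, then $e$ does not come back in $F$, and $\#T(e)<|e|$. Equivalently for the last conclusion, if $\#T(e)\ge |e|$ then $\#U(e)=0$.
   Context: For an integer $N\ge 0$, take upper nodes $1,\dots,N$ and lower nodes $1',\dots,N'$ arranged in two rows. A tangle is a set of $N$ edges such that each node is in exactly one edge (a perfect matching of the $2N$ nodes). The composition $X\circ Y$ is obtained by stacking $X$ on top of $Y$, identifying lower node $i'$ of $X$ with upper node $i$ of $Y$, tracing paths, and discarding internal loops. The Brauer monoid $\mathcal{B}_N$ is the monoid of all tangles, with identity $I_N=\{(i,i'):1\le i\le N\}$. It is generated by the primes, for $1\le i\le N-1$: the $T$-prime $T_i$, obtained from $I_N$ by replacing $(i,i'),(i+1,(i+1)')$ with $(i,(i+1)'),(i+1,i')$; and the $U$-prime $U_i$, obtained from $I_N$ by replacing these two edges with $(i,i+1),(i',(i+1)')$. A factorization of $X$ is a word in the primes whose composition is $X$ (the empty word is a factorization of $I_N$); it is minimal if no shorter word has the same composition. The size of an edge $e=(x,y)$ is $|e|=|x-y|$, primes on labels being ignored. Given a factorization $F$ of $X$, an edge $e$ of $X$ is a path through the stacked primes of $F$. The edge $e$ passes through a prime $p_i$ of $F$ (of index $i$) if this path is connected to node $i$ or $i'$ of $p_i$, i.e. uses one of the two non-identity edges of that prime. $\#T(e)$ and $\#U(e)$ are the numbers of $T$-primes and $U$-primes of $F$ that $e$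 passes through. The edge $e$ comes back at a prime $p$ if the size of $e$ decreases when passing through $p$, i.e. tracing $e$ from one endpoint, the horizontal distance from the starting column to the current column decreases when traversing $p$. The edge $e$ comes back in $F$ if it comes back at some prime of $F$. Rewriting rules on words. Delete rules (applied left to right): $T_iT_i\to$ empty word; $U_iU_i\to U_i$; $T_iU_i\to U_i$; $U_iT_i\to U_i$; and for $|i-j|=1$: $U_iU_jU_i\to U_i$; $U_iT_jU_i\to U_i$; $T_iU_jU_i\to T_jU_i$; $U_iU_jT_i\to U_iT_j$; $U_iT_jT_i\to U_iU_j$; $T_iT_jU_i\to U_jU_i$. Braid rules, for $|i-j|=1$: $T_iT_jT_i= T_jT_iT_j$; $T_iU_jT_i= T_jU_iT_j$. Swap rules, for $|i-j|>1$: any prime of index $i$ commutes with any prime of index $j$. Assumption 1: for every $N$, every factorization in $\mathcal{B}_N$ can be transformed into a minimal one by a sequence of delete, braid and swap rules (the length never needs to be increased). *)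

theory Defs
  imports Main
begin

datatype node = Upper nat | Lower nat

fun column :: "node \<Rightarrow> nat" where
  "column (Upper i) = i"
| "column (Lower i) = i"

definition nodes :: "nat \<Rightarrow> node set" where
  "nodes N = Upper ` {1..N} \<union> Lower ` {1..N}"

type_synonym edge = "node set"
type_synonym tangle = "edge set"

text \<open>The carrier of the Brauer monoid: all perfect matchings of the \<open>2 * N\<close> nodes.\<close>

definition brauer :: "nat \<Rightarrow> tangle set" where
  "brauer N = {X. (\<forall>e\<in>X. e \<subseteq> nodes N \<and> card e = 2) \<and>
                  (\<forall>v\<in>nodes N. \<exists>!e. e \<in> X \<and> v \<in> e)}"

definition edge_size :: "edge \<Rightarrow> nat" where
  "edge_size e =
     (THE d. \<exists>x y. e = {x, y} \<and> d = nat \<bar>int (column x) - int (column y)\<bar>)"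

lemma edge_size_pair: "edge_size {x, y} = nat \<bar>int (column x) - int (column y)\<bar>"
  unfolding edge_size_def by (rule the_equality) (auto simp: doubleton_eq_iff)


text \<open>
  Stack the tangles of a list on top of each other, the head of the list being the topmost.
  The diagram has levels \<open>0, \<dots>, length Xs\<close>; tangle number \<open>k\<close> lies between the levels
  \<open>k\<close> and \<open>k + 1\<close>, so its lower nodes are identified with the upper nodes of
  tangle number \<open>k + 1\<close>. A strand \<open>(k, a, b)\<close> is the edge \<open>{a, b}\<close> of tangle number
  \<open>k\<close>, traversed from \<open>a\<close> to \<open>b\<close>.
\<close>

type_synonym strand = "nat \<times> node \<times> node"

fun position :: "nat \<Rightarrow> node \<Rightarrow> nat \<times> nat" where
  "position k (Upper i) = (k, i)"
| "position k (Lower i) = (Suc k, i)"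

fun outer_position :: "nat \<Rightarrow> node \<Rightarrow> nat \<times> nat" where
  "outer_position n (Upper i) = (0, i)"
| "outer_position n (Lower i) = (n, i)"

text \<open>
  A trace from the outer node \<open>x\<close> to the outer node \<open>y\<close>. On reaching an interior level, the
  path goes on in the other tangle meeting that level, hence \<open>k \<noteq> k'\<close>; this excludes
  backtracking. The empty trace between distinct \<open>x\<close> and \<open>y\<close> exists only in the empty stack,
  where the two outer nodes of each column coincide.
\<close>

definition linked :: "strand \<Rightarrow> strand \<Rightarrow> bool" where
  "linked = (\<lambda>(k, a, b) (k', a', b'). k \<noteq> k' \<and> position k b = position k' a')"

definition trace :: "tangle list \<Rightarrow> node \<Rightarrow> strand list \<Rightarrow> node \<Rightarrow> bool" where
  "trace Xs x ss y \<longleftrightarrow>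
     (\<forall>(k, a, b)\<in>set ss. k < length Xs \<and> {a, b} \<in> Xs ! k) \<and>
     successively linked ss \<and>
     (if ss = [] then outer_position (length Xs) x = outer_position (length Xs) y
      else (case hd ss of (k, a, b) \<Rightarrow> position k a = outer_position (length Xs) x) \<and>
           (case last ss of (k, a, b) \<Rightarrow> position k b = outer_position (length Xs) y))"

definition compose :: "tangle \<Rightarrow> tangle \<Rightarrow> tangle" where
  "compose X Y = {{x, y} | x y. x \<noteq> y \<and> (\<exists>ss. trace [X, Y] x ss y)}"

definition id_tangle :: "nat \<Rightarrow> tangle" where
  "id_tangle N = {{Upper i, Lower i} | i. 1 \<le> i \<and> i \<le> N}"


datatype brauer_prime = is_T_prime: T_prime (index: nat) | is_U_prime: U_prime (index: nat)

fun prime_tangle :: "nat \<Rightarrow> brauer_prime \<Rightarrow> tangle" where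
  "prime_tangle N (T_prime i) =
     id_tangle N - {{Upper i, Lower i}, {Upper (i + 1), Lower (i + 1)}}
       \<union> {{Upper i, Lower (i + 1)}, {Upper (i + 1), Lower i}}"
| "prime_tangle N (U_prime i) =
     id_tangle N - {{Upper i, Lower i}, {Upper (i + 1), Lower (i + 1)}}
       \<union> {{Upper i, Upper (i + 1)}, {Lower i, Lower (i + 1)}}"

type_synonym word = "brauer_prime list"

definition words :: "nat \<Rightarrow> word set" where
  "words N = {F. \<forall>p\<in>set F. 1 \<le> index p \<and> index p < N}"

definition word_tangle :: "nat \<Rightarrow> word \<Rightarrow> tangle" where
  "word_tangle N F = foldr (\<lambda>p X. compose (prime_tangle N p) X) F (id_tangle N)"

definition factorization :: "nat \<Rightarrow> tangle \<Rightarrow> word \<Rightarrow> bool" where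
  "factorization N X F \<longleftrightarrow> F \<in> words N \<and> word_tangle N F = X"

definition minimal_factorization :: "nat \<Rightarrow> tangle \<Rightarrow> word \<Rightarrow> bool" where
  "minimal_factorization N X F \<longleftrightarrow>
     factorization N X F \<and> (\<forall>G. factorization N X G \<longrightarrow> length F \<le> length G)"


text \<open>
  The path of an edge \<open>e\<close> through the stacked primes of \<open>F\<close>, traced from either of its
  endpoints: \<open>x\<close> is the endpoint at which tracing starts.
\<close>

definition edge_trace :: "nat \<Rightarrow> word \<Rightarrow> edge \<Rightarrow> node \<Rightarrow> strand list \<Rightarrow> bool" where
  "edge_trace N F e x ss \<longleftrightarrow>
     (\<exists>y. x \<noteq> y \<and> e = {x, y} \<and> trace (map (prime_tangle N) F) x ss y)"

text \<open>Primes of a word are referred to by their position \<open>k\<close>, not by their value.\<close>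

definition passes_through :: "nat \<Rightarrow> word \<Rightarrow> edge \<Rightarrow> nat \<Rightarrow> bool" where
  "passes_through N F e k \<longleftrightarrow>
     (\<exists>x ss a b. edge_trace N F e x ss \<and> (k, a, b) \<in> set ss \<and>
        (Upper (index (F ! k)) \<in> {a, b} \<or> Lower (index (F ! k)) \<in> {a, b}))"

definition num_T :: "nat \<Rightarrow> word \<Rightarrow> edge \<Rightarrow> nat" where
  "num_T N F e = card {k. k < length F \<and> is_T_prime (F ! k) \<and> passes_through N F e k}"

definition num_U :: "nat \<Rightarrow> word \<Rightarrow> edge \<Rightarrow> nat" where
  "num_U N F e = card {k. k < length F \<and> is_U_prime (F ! k) \<and> passes_through N F e k}"

definition comes_back_at :: "nat \<Rightarrow> word \<Rightarrow> edge \<Rightarrow> nat \<Rightarrow> bool" where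
  "comes_back_at N F e k \<longleftrightarrow>
     (\<exists>x ss a b. edge_trace N F e x ss \<and> (k, a, b) \<in> set ss \<and>
        \<bar>int (column b) - int (column x)\<bar> < \<bar>int (column a) - int (column x)\<bar>)"

definition comes_back :: "nat \<Rightarrow> word \<Rightarrow> edge \<Rightarrow> bool" where
  "comes_back N F e \<longleftrightarrow> (\<exists>k<length F. comes_back_at N F e k)"


definition adjacent :: "nat \<Rightarrow> nat \<Rightarrow> bool" where
  "adjacent i j \<longleftrightarrow> \<bar>int i - int j\<bar> = 1"

inductive delete_rule :: "word \<Rightarrow> word \<Rightarrow> bool" where
  "delete_rule [T_prime i, T_prime i] []"
| "delete_rule [U_prime i, U_prime i] [U_prime i]"
| "delete_rule [T_prime i, U_prime i] [U_prime i]"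
| "delete_rule [U_prime i, T_prime i] [U_prime i]"
| "adjacent i j \<Longrightarrow> delete_rule [U_prime i, U_prime j, U_prime i] [U_prime i]"
| "adjacent i j \<Longrightarrow> delete_rule [U_prime i, T_prime j, U_prime i] [U_prime i]"
| "adjacent i j \<Longrightarrow> delete_rule [T_prime i, U_prime j, U_prime i] [T_prime j, U_prime i]"
| "adjacent i j \<Longrightarrow> delete_rule [U_prime i, U_prime j, T_prime i] [U_prime i, T_prime j]"
| "adjacent i j \<Longrightarrow> delete_rule [U_prime i, T_prime j, T_prime i] [U_prime i, U_prime j]"
| "adjacent i j \<Longrightarrow> delete_rule [T_prime i, T_prime j, U_prime i] [U_prime j, U_prime i]"

text \<open>The braid and swap rules are symmetric as relations, so they can be used in both directions.\<close>

inductive braid_rule :: "word \<Rightarrow> word \<Rightarrow> bool" where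
  "adjacent i j \<Longrightarrow>
     braid_rule [T_prime i, T_prime j, T_prime i] [T_prime j, T_prime i, T_prime j]"
| "adjacent i j \<Longrightarrow>
     braid_rule [T_prime i, U_prime j, T_prime i] [T_prime j, U_prime i, T_prime j]"

inductive swap_rule :: "word \<Rightarrow> word \<Rightarrow> bool" where
  "\<bar>int (index p) - int (index q)\<bar> > 1 \<Longrightarrow> swap_rule [p, q] [q, p]"

definition rewrite_step :: "word \<Rightarrow> word \<Rightarrow> bool" where
  "rewrite_step F G \<longleftrightarrow>
     (\<exists>A B L R. F = A @ L @ B \<and> G = A @ R @ B \<and>
        (delete_rule L R \<or> braid_rule L R \<or> swap_rule L R))"

definition assumption1 :: bool where
  "assumption1 \<longleftrightarrow>
     (\<forall>N X F. X \<in> brauer N \<longrightarrow> factorization N X F \<longrightarrow>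
        (\<exists>G. rewrite_step\<^sup>*\<^sup>* F G \<and> minimal_factorization N X G))"

end

theory Submission imports Defs begin

text \<open>
  Let \<open>w(e)\<close> be the maximum of \<open>|e|\<close> and of the number \<open>cr(e)\<close> of edges crossing \<open>e\<close>. The length of
  \<open>X\<close> is half the sum of \<open>w(e)\<close> over all edges. In any word an edge \<open>e\<close> makes at least \<open>|e|\<close>
  horizontal moves and at least \<open>cr(e)\<close> of them in \<open>T\<close>-primes, while each prime is used by two
  moves; conversely every tangle other than the identity admits a prime on top whose removal lowers
  the sum by two. Hence in a minimal word every edge makes exactly \<open>w(e)\<close> moves. If one of
  them is in a \<open>U\<close>-prime, their number exceeds \<open>cr(e)\<close>, so it equals \<open>|e|\<close>, which forces the
  path to be monotone.
\<close>

text \<open>The constant 4 comes from counting twice: \<open>total_weight\<close> sums over nodes,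
  so every edge counts from both of its ends, and a prime has two non-identity edges. Both bounds
  are inductions on the topmost prime. In the lower bound, a \<open>U\<close>-prime gives a joined
  edge no more crossings than its pieces had together, since whatever crosses the joined edge
  crosses one of them; a \<open>T\<close>-prime adds at most one crossing to an edge, and only to
  one that moves in it. Hence crossings can be charged to moves in \<open>T\<close>-primes alone. In
  the upper bound, the obstacle is that a maximum falls only if each argument attaining it does:
  removing a prime has to control sizes and crossings at once, and must not make any third edge
  heavier. For a \<open>T\<close>-prime this needs a parity argument about vertical edges. For a
  \<open>U\<close>-prime, whose removal trades a cup and a further edge for two others, each new
  edge must enclose so many nodes that its size dominates its crossings.\<close>

subsection \<open>Matchings on signed columns\<close>

text \<open>
  The upper node of column \<open>c\<close> is encoded as \<open>c\<close>, the lower one as \<open>- c\<close>: the order of the integers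
  is then the cyclic order of the nodes around the diagram, cut between the two rightmost ones, so
  two edges cross iff exactly one end of one of them lies between the ends of the other.
\<close>

definition points :: "nat \<Rightarrow> int set" where
  "points N = {z. z \<noteq> 0 \<and> \<bar>z\<bar> \<le> int N}"

lemma finite_points [simp]: "finite (points N)"
  by (rule finite_subset[of _ "{- int N..int N}"]) (auto simp: points_def)

definition matching :: "nat \<Rightarrow> (int \<Rightarrow> int) \<Rightarrow> bool" where
  "matching N m \<longleftrightarrow> (\<forall>z\<in>points N. m z \<in> points N \<and> m z \<noteq> z \<and> m (m z) = z)"

definition between :: "int \<Rightarrow> int \<Rightarrow> int \<Rightarrow> bool" where
  "between x z y \<longleftrightarrow> (x < z \<and> z < y) \<or> (y < z \<and> z < x)"

definition crossings :: "nat \<Rightarrow> (int \<Rightarrow> int) \<Rightarrow> int \<Rightarrow> nat" where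
  "crossings N m x = card {z \<in> points N. between x z (m x) \<and> \<not> between x (m z) (m x)}"

text \<open>Both ends of every edge that crosses the one at \<open>x\<close>. Unlike the set counted
  by \<open>crossings\<close>, this one is closed under \<open>m\<close>, so it can be compared
  point by point after nodes have been moved.\<close>

definition crossers :: "nat \<Rightarrow> (int \<Rightarrow> int) \<Rightarrow> int \<Rightarrow> int set" where
  "crossers N m x = {z \<in> points N. between x z (m x) \<noteq> between x (m z) (m x)}"

definition width :: "(int \<Rightarrow> int) \<Rightarrow> int \<Rightarrow> nat" where
  "width m x = nat \<bar>\<bar>x\<bar> - \<bar>m x\<bar>\<bar>"

definition weight :: "nat \<Rightarrow> (int \<Rightarrow> int) \<Rightarrow> int \<Rightarrow> nat" where
  "weight N m x = max (width m x) (crossings N m x)"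

definition total_weight :: "nat \<Rightarrow> (int \<Rightarrow> int) \<Rightarrow> nat" where
  "total_weight N m = (\<Sum>x\<in>points N. weight N m x)"

lemma between_commute: "between x z y \<longleftrightarrow> between y z x"
  by (auto simp: between_def)

lemma matchingD:
  assumes "matching N m" "z \<in> points N"
  shows "m z \<in> points N" "m z \<noteq> z" "m (m z) = z"
  using assms by (auto simp: matching_def)

lemma matching_eq_iff:
  assumes "matching N m" "x \<in> points N" "y \<in> points N"
  shows "m x = m y \<longleftrightarrow> x = y" "m x = y \<longleftrightarrow> x = m y"
  using assms by (metis matchingD(3))+

lemma finite_crossers [simp]: "finite (crossers N m x)"
  by (simp add: crossers_def)

lemma card_crossers:
  assumes "matching N m"
  shows "card (crossers N m x) = 2 * crossings N m x"
proof -
  let ?C = "{z \<in> points N. between x z (m x) \<and> \<not> between x (m z) (m x)}"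
  have inj: "inj_on m ?C"
    by (rule inj_onI) (use assms in \<open>auto simp: matching_eq_iff\<close>)
  have "crossers N m x = ?C \<union> m ` ?C" (is "?L = ?R")
  proof
    show "?L \<subseteq> ?R"
    proof
      fix z assume z: "z \<in> ?L"
      then have "m (m z) = z" "m z \<in> points N"
        using assms by (auto simp: crossers_def matchingD)
      then show "z \<in> ?R" using z by (auto simp: crossers_def image_iff intro!: bexI[of _ "m z"])
    qed
    show "?R \<subseteq> ?L" using assms by (auto simp: crossers_def matchingD)
  qed
  moreover have "?C \<inter> m ` ?C = {}" using assms by (auto simp: matchingD)
  ultimately show ?thesis
    by (simp add: card_Un_disjoint card_image[OF inj] crossings_def)
qed

lemma width_partner: "matching N m \<Longrightarrow> x \<in> points N \<Longrightarrow> width m (m x) = width m x"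
  by (simp add: width_def matchingD abs_minus_commute)

lemma crossings_partner: "matching N m \<Longrightarrow> x \<in> points N \<Longrightarrow> crossings N m (m x) = crossings N m x"
  by (simp add: crossings_def matchingD between_commute)

lemma weight_partner: "matching N m \<Longrightarrow> x \<in> points N \<Longrightarrow> weight N m (m x) = weight N m x"
  by (simp add: weight_def width_partner crossings_partner)

text \<open>Strictly between two ends in the same row there are only \<open>width m x - 1\<close>
  nodes, and each crossing edge uses one of them. The weight of such an edge is therefore its
  size.\<close>

lemma crossings_cup:
  assumes "matching N m" "x \<in> points N" "x * m x > 0"
  shows "crossings N m x < width m x"
proof -
  let ?a = "min x (m x)" and ?b = "max x (m x)"
  have ne: "x \<noteq> m x" using assms matchingD(2) by metis
  have "crossings N m x \<le> card {?a + 1..?b - 1}"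
    unfolding crossings_def by (rule card_mono) (auto simp: between_def)
  also have "\<dots> = nat (?b - ?a - 1)" by simp
  also have "\<dots> < width m x"
    using ne assms(3) by (auto simp: width_def zero_less_mult_iff)
  finally show ?thesis .
qed

text \<open>The interval of a through edge holds \<open>x - m x - 2\<close> nodes, as 0 is not a
  node, and those matched inside the interval lie on no crossing edge. In every application
  \<open>S\<close> is just large enough to bring the bound down to the width.\<close>

lemma crossings_through:
  assumes "x > 0" "m x < 0" "finite S"
    and S: "\<And>z. z \<in> S \<Longrightarrow> m x < z \<and> z < x \<and> z \<noteq> 0 \<and> m x < m z \<and> m z < x"
  shows "int (crossings N m x) + int (card S) \<le> x - m x - 2"
proof -
  let ?C = "{z \<in> points N. between x z (m x) \<and> \<not> between x (m z) (m x)}"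
  have "card (?C \<union> S) \<le> card ({m x + 1..x - 1} - {0})"
    by (rule card_mono) (use assms(1,2) in \<open>auto simp: between_def points_def dest: S\<close>)
  also have "\<dots> = nat (x - m x - 1) - 1" using assms by (subst card_Diff_singleton) auto
  finally have "card (?C \<union> S) \<le> nat (x - m x - 1) - 1" .
  moreover have "?C \<inter> S = {}" using assms by (auto simp: between_def)
  then have "card (?C \<union> S) = card ?C + card S" using assms(3) by (simp add: card_Un_disjoint)
  ultimately show ?thesis using assms unfolding crossings_def by linarith
qed

lemma even_card_involution:
  assumes "finite S" "\<And>z. z \<in> S \<Longrightarrow> m z \<in> S \<and> m z \<noteq> z \<and> m (m z) = z"
  shows "even (card S)"
  using assms
proof (induction "card S" arbitrary: S rule: less_induct)
  case less
  show ?case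
  proof (cases "S = {}")
    case False
    then obtain x where x: "x \<in> S" by auto
    let ?S = "S - {x, m x}"
    have ne: "m x \<noteq> x" using less.prems(2)[OF x] by simp
    have "card ?S = card S - card {x, m x}"
      using less.prems x by (intro card_Diff_subset) auto
    then have "card ?S = card S - 2" using ne by (simp add: card_insert_if)
    moreover have "card {x, m x} \<le> card S"
      using less.prems x by (intro card_mono) auto
    then have "2 \<le> card S" using ne by (simp add: card_insert_if)
    ultimately have c: "card S = card ?S + 2" by simp
    have "even (card ?S)"
    proof (rule less.hyps)
      fix z assume z: "z \<in> ?S"
      then have "m z \<in> S" "m z \<noteq> z" "m (m z) = z" "m (m x) = x"
        using less.prems(2) x by auto
      then show "m z \<in> ?S \<and> m z \<noteq> z \<and> m (m z) = z" using z by auto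
    qed (use c less.prems in auto)
    then show ?thesis using c by simp
  qed simp
qed

subsection \<open>Moves\<close>

definition transp :: "int \<Rightarrow> int \<Rightarrow> int" where
  "transp i z = (if z = i then i + 1 else if z = i + 1 then i else z)"

text \<open>The effect of stacking \<open>T_prime i\<close> on top: for \<open>i > 0\<close> only
  the upper nodes \<open>i\<close> and \<open>i + 1\<close> are exchanged.\<close>

definition act_T :: "int \<Rightarrow> (int \<Rightarrow> int) \<Rightarrow> int \<Rightarrow> int" where
  "act_T i m z = transp i (m (transp i z))"

lemma transp_transp [simp]: "transp i (transp i z) = z" by (simp add: transp_def)

lemma transp_eq_iff [simp]: "transp i x = transp i y \<longleftrightarrow> x = y" by (auto simp: transp_def)

lemma transp_points: "0 < i \<Longrightarrow> i < int N \<Longrightarrow> transp i z \<in> points N \<longleftrightarrow> z \<in> points N"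
  by (auto simp: transp_def points_def)

lemma act_T_act_T [simp]: "act_T i (act_T i m) = m"
  by (simp add: act_T_def fun_eq_iff)

lemma matching_act_T:
  assumes "matching N m" "0 < i" "i < int N"
  shows "matching N (act_T i m)"
proof -
  have "act_T i m z \<in> points N \<and> act_T i m z \<noteq> z \<and> act_T i m (act_T i m z) = z"
    if "z \<in> points N" for z
  proof -
    have z: "transp i z \<in> points N" using that assms by (simp add: transp_points)
    have "transp i (m (transp i z)) \<noteq> transp i (transp i z)"
      using matchingD(2)[OF assms(1) z] by (simp only: transp_eq_iff simp_thms)
    then show ?thesis
      using matchingD[OF assms(1) z] assms by (simp add: act_T_def transp_points)
  qed
  then show ?thesis by (simp add: matching_def)
qed

section \<open>Crossing numbers when two neighbouring upper nodes are exchanged\<close>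

lemma transp_less_iff:
  assumes "\<not> (i \<in> {x, y} \<and> i + 1 \<in> {x, y})"
  shows "transp i x < transp i y \<longleftrightarrow> x < y"
  using assms by (auto simp: transp_def)

lemma between_transp:
  assumes "\<not> (i \<in> {x, y, z} \<and> i + 1 \<in> {x, y, z})"
  shows "between (transp i x) (transp i z) (transp i y) = between x z y"
proof -
  have "transp i a < transp i b \<longleftrightarrow> a < b" if "{a, b} \<subseteq> {x, y, z}" for a b
    using that assms by (intro transp_less_iff) auto
  then show ?thesis by (simp add: between_def)
qed

text \<open>Exchanging two consecutive integers reverses no comparison except that of the two with
  each other. So a crossing can appear only if both of them occur among the ends compared.\<close>

lemma crossers_act_T_aux:
  assumes i: "0 < i" "i < int N"
    and z: "transp i z \<in> crossers N (act_T i m) (transp i x)"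
    and *: "\<not> (i \<in> {x, m x, z} \<and> i + 1 \<in> {x, m x, z})"
           "\<not> (i \<in> {x, m x, m z} \<and> i + 1 \<in> {x, m x, m z})"
  shows "z \<in> crossers N m x"
proof -
  have "between (transp i x) (transp i z) (transp i (m x)) = between x z (m x)"
    using *(1) by (intro between_transp) blast
  moreover have "between (transp i x) (transp i (m z)) (transp i (m x)) = between x (m z) (m x)"
    using *(2) by (intro between_transp) blast
  ultimately show ?thesis using z i by (simp add: crossers_def act_T_def transp_points)
qed

lemma card_le_transp: 
  "(\<And>z. transp i z \<in> A \<Longrightarrow> z \<in> B) \<Longrightarrow> finite B \<Longrightarrow> card A \<le> card B"
  by (rule surj_card_le[of B A "transp i"]) (auto, metis image_eqI transp_transp)

lemma crossings_act_T_untouched: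
  assumes "matching N m" "0 < i" "i < int N" "x \<in> points N"
    and "{x, m x} \<inter> {i, i + 1} = {}"
  shows "crossings N (act_T i m) (transp i x) \<le> crossings N m x"
proof -
  have "card (crossers N (act_T i m) (transp i x)) \<le> card (crossers N m x)"
    by (rule card_le_transp[of i], rule crossers_act_T_aux[OF assms(2,3)]) (use assms in auto)
  then show ?thesis by (simp add: card_crossers assms matching_act_T)
qed

text \<open>Only the edge at the other exchanged node can start to cross the edge at
  \<open>x\<close>. Its two ends are the two additional crossers, which make one crossing.\<close>

lemma crossings_act_T_touched:
  assumes "matching N m" "0 < i" "i < int N" "x \<in> {i, i + 1}"
  shows "crossings N (act_T i m) (transp i x) \<le> crossings N m x + 1"
proof (cases "m x \<in> {i, i + 1}")
  case True
  have "i \<in> points N" "i + 1 \<in> points N" using assms by (auto simp: points_def)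
  then have mi: "m i = i + 1" "m (i + 1) = i"
    using True assms matchingD[OF assms(1)] by (metis insertE singletonD)+
  have "crossings N (act_T i m) (transp i x) = 0"
  proof -
    have "{transp i x, act_T i m (transp i x)} = {i, i + 1}"
      using assms(4) mi by (auto simp: act_T_def transp_def)
    then have "\<not> between (transp i x) z (act_T i m (transp i x))" for z
      by (auto simp: between_def doubleton_eq_iff)
    then show ?thesis by (simp add: crossings_def)
  qed
  then show ?thesis by simp
next
  case False
  let ?y = "transp i x"
  have p: "x \<in> points N" "?y \<in> points N" using assms by (auto simp: points_def transp_def)
  have "card (crossers N (act_T i m) ?y) \<le> card (crossers N m x \<union> {?y, m ?y})"
  proof (rule card_le_transp[of i])
    fix z assume z: "transp i z \<in> crossers N (act_T i m) ?y"
    show "z \<in> crossers N m x \<union> {?y, m ?y}"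
    proof (cases "z \<in> {?y, m ?y}")
      case zF: False
      have "z \<in> points N" using z assms by (simp add: crossers_def transp_points)
      then have "m z \<noteq> ?y" using zF p assms(1) by (metis insertCI matchingD(3))
      then have "z \<in> crossers N m x"
        using zF False assms(4)
        by (intro crossers_act_T_aux[OF assms(2,3) z]) (auto simp: transp_def)
      then show ?thesis by simp
    qed auto
  qed simp
  also have "\<dots> \<le> card (crossers N m x) + card {?y, m ?y}" by (rule card_Un_le)
  also have "\<dots> \<le> card (crossers N m x) + 2" by (simp add: card_insert_if)
  finally show ?thesis by (simp add: card_crossers assms matching_act_T)
qed

text \<open>Here that exceptional edge crosses before the exchange and not after it, so both of its
  ends leave the set of crossers.\<close>

lemma crossings_act_T_crossing:
  assumes "matching N m" "0 < i" "i < int N" "x \<in> {i, i + 1}" "m x \<notin> {i, i + 1}"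
    and "transp i x \<in> crossers N m x" and "x \<notin> crossers N (act_T i m) (transp i x)"
  shows "crossings N (act_T i m) (transp i x) + 1 \<le> crossings N m x"
proof -
  let ?y = "transp i x" and ?m = "act_T i m"
  have p: "x \<in> points N" "?y \<in> points N" using assms by (auto simp: points_def transp_def)
  have my: "m ?y \<in> crossers N m x" using assms(6) assms(1) p
    by (auto simp: crossers_def matchingD)
  have m': "matching N ?m" using assms by (simp add: matching_act_T)
  have mm: "?m x \<notin> crossers N ?m ?y"
    using assms(7) m' p by (auto simp: crossers_def matchingD)
  have ne: "m ?y \<noteq> ?y" using matchingD[OF assms(1) p(2)] by simp
  have "card (crossers N ?m ?y) \<le> card (crossers N m x - {?y, m ?y})"
  proof (rule card_le_transp[of i])
    fix z assume z: "transp i z \<in> crossers N ?m ?y"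
    have zp: "z \<in> points N" using z assms by (simp add: crossers_def transp_points)
    have zF: "z \<noteq> ?y" using z assms(7) by auto
    have zm: "z \<noteq> m ?y" using z mm by (auto simp: act_T_def)
    have "m z \<noteq> ?y" using zm zp p assms(1) by (metis matchingD(3))
    then have "z \<in> crossers N m x"
      using zF zm assms(4,5)
      by (intro crossers_act_T_aux[OF assms(2,3) z]) (auto simp: transp_def)
    then show "z \<in> crossers N m x - {?y, m ?y}" using zF zm by simp
  qed simp
  also have "\<dots> = card (crossers N m x) - 2"
    using assms(6) my ne by (subst card_Diff_subset) auto
  finally have "card (crossers N ?m ?y) \<le> card (crossers N m x) - 2" .
  moreover have "card {?y, m ?y} \<le> card (crossers N m x)"
    using assms(6) my by (intro card_mono) auto
  then have "2 \<le> card (crossers N m x)" using ne by (simp add: card_insert_if)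
  ultimately show ?thesis using assms m' by (simp add: card_crossers)
qed


text \<open>Inside a vertical edge lie twice \<open>i - 1\<close> nodes. Those on no crossing edge
  are matched among themselves, which leaves an even number for the crossing edges.\<close>

lemma even_crossings_straight:
  assumes "matching N m" "0 < i" "i \<le> int N" "m i = - i"
  shows "even (crossings N m i)"
proof -
  let ?C = "{z \<in> points N. between i z (m i) \<and> \<not> between i (m z) (m i)}"
  let ?S = "{z \<in> points N. between i z (m i) \<and> between i (m z) (m i)}"
  have "?C \<union> ?S = {- i + 1..i - 1} - {0}"
    using assms by (auto simp: between_def points_def)
  moreover have "?C \<inter> ?S = {}" by auto
  ultimately have "card ?C + card ?S = card ({- i + 1..i - 1} - {0})"
    by (subst card_Un_disjoint[symmetric]) auto
  also have "\<dots> = nat (2 * (i - 1))" using assms by (subst card_Diff_singleton) auto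
  also have "even \<dots>" using assms by (simp add: even_nat_iff)
  finally have "even (card ?C + card ?S)" .
  moreover have "even (card ?S)"
    by (rule even_card_involution[of _ m]) (use assms in \<open>auto simp: matchingD\<close>)
  ultimately show ?thesis by (simp add: crossings_def)
qed

text \<open>The edge at \<open>i\<close> is vertical or goes right, and the one at
  \<open>i + 1\<close> goes left, so the two cross. Uncrossing them lowers the weight of each by at
  least one, which counts at four nodes.\<close>

lemma T_move:
  assumes m: "matching N m" and i: "0 < i" "i < int N"
    and left: "i \<le> \<bar>m i\<bar>" and right: "\<bar>m (i + 1)\<bar> \<le> i" and ne: "m i \<noteq> i + 1"
  shows "total_weight N (act_T i m) + 4 \<le> total_weight N m"
proof -
  let ?m = "act_T i m" and ?j = "i + 1"
  define M K where "M = m i" and "K = m ?j"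
  have p: "i \<in> points N" "?j \<in> points N" using i by (auto simp: points_def)
  have m': "matching N ?m" using m i by (rule matching_act_T)
  have MK: "M \<in> points N" "M \<noteq> i" "m M = i" "K \<in> points N" "K \<noteq> ?j" "m K = ?j"
    using matchingD[OF m p(1)] matchingD[OF m p(2)] by (auto simp: M_def K_def)
  have MK': "M \<noteq> ?j" "K \<noteq> i" "M \<noteq> K" using ne MK by (auto simp: M_def)
  have K: "- i \<le> K" "K < i" using right MK' unfolding K_def[symmetric] by auto
  \<comment> \<open>Either position of \<open>M\<close> puts exactly one end of each edge between
    the ends of the other.\<close>
  have M: "?j < M \<or> M < K" using left MK MK' K unfolding M_def[symmetric] by auto
  have vals: "?m ?j = M" "?m i = K" using MK MK'
    by (auto simp: act_T_def transp_def M_def K_def)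
  have tr: "transp i i = ?j" "transp i ?j = i" "transp i M = M" "transp i K = K"
    using MK MK' by (auto simp: transp_def)
  have c: "?j \<in> crossers N m i" "i \<notin> crossers N ?m ?j"
       "i \<in> crossers N m ?j" "?j \<notin> crossers N ?m i"
    using K M p unfolding crossers_def mem_Collect_eq vals M_def[symmetric] K_def[symmetric]
      between_def by linarith+
  have cr1: "crossings N ?m ?j + 1 \<le> crossings N m i"
    using crossings_act_T_crossing[OF m i, of i] MK MK' c tr by (simp add: M_def)
  have cr2: "crossings N ?m i + 1 \<le> crossings N m ?j"
    using crossings_act_T_crossing[OF m i, of ?j] MK MK' c tr by (simp add: K_def)
  have w1: "weight N ?m ?j + 1 \<le> weight N m i"
  proof (cases "\<bar>M\<bar> = i")
    case True
    then have "M = - i" using MK by auto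
    \<comment> \<open>A vertical edge grows to size 1, so a single crossing would not pay for the move.\<close>
    then have "even (crossings N m i)" using m i by (intro even_crossings_straight) (auto simp: M_def)
    then have "2 \<le> crossings N m i" using cr1
      by (auto elim!: evenE)
    moreover have "width ?m ?j = 1" using True vals i by (simp add: width_def)
    ultimately show ?thesis using cr1 by (simp add: weight_def)
  next
    case False
    then have "width ?m ?j + 1 = width m i" 
      using vals i left by (simp add: width_def M_def[symmetric])
    then show ?thesis using cr1 by (simp add: weight_def)
  qed
  have "width ?m i + 1 = width m ?j"
    using vals i K by (simp add: width_def K_def[symmetric])
  then have w2: "weight N ?m i + 1 \<le> weight N m ?j" using cr2 by (simp add: weight_def)
  have w3: "weight N ?m M + 1 \<le> weight N m M"
    using w1 weight_partner[OF m' p(2)] weight_partner[OF m p(1)] vals by (simp add: M_def)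
  have w4: "weight N ?m K + 1 \<le> weight N m K"
    using w2 weight_partner[OF m' p(1)] weight_partner[OF m p(2)] vals by (simp add: K_def)
  let ?Q = "{i, ?j, M, K}"
  have le: "weight N ?m (transp i x) + (if x \<in> ?Q then 1 else 0) \<le> weight N m x"
    if x: "x \<in> points N" for x
  proof (cases "x \<in> ?Q")
    case True
    then show ?thesis using w1 w2 w3 w4 tr by auto
  next
    case False
    then have mx: "{x, m x} \<inter> {i, ?j} = {}"
      using x p matching_eq_iff(2)[OF m] by (auto simp: M_def K_def)
    then have "?m (transp i x) = m x" "transp i x = x" by (auto simp: act_T_def transp_def)
    then have "width ?m (transp i x) = width m x" by (simp add: width_def)
    then show ?thesis using False crossings_act_T_untouched[OF m i x mx] by (auto simp: weight_def)
  qed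
  have bij: "bij_betw (transp i) (points N) (points N)"
    by (rule bij_betw_byWitness[of _ "transp i"]) (use i in \<open>auto simp: transp_points\<close>)
  have "card ?Q = 4" using MK MK' by (auto simp: card_insert_if)
  moreover have "(\<Sum>x\<in>points N. if x \<in> ?Q then 1 else 0) = card ?Q"
    using p MK by (subst sum.inter_restrict[symmetric]) (auto intro!: arg_cong[of _ _ card])
  moreover have "total_weight N ?m = (\<Sum>x\<in>points N. weight N ?m (transp i x))"
    unfolding total_weight_def by (rule sum.reindex_bij_betw[OF bij, symmetric])
  ultimately have "total_weight N ?m + 4 =
      (\<Sum>x\<in>points N. weight N ?m (transp i x) + (if x \<in> ?Q then 1 else 0))"
    by (simp only: sum.distrib)
  also have "\<dots> \<le> total_weight N m"
    unfolding total_weight_def by (rule sum_mono) (rule le)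
  finally show ?thesis .
qed

section \<open>A \<open>U\<close>-prime on top, and its removal\<close>

definition act_U :: "int \<Rightarrow> (int \<Rightarrow> int) \<Rightarrow> int \<Rightarrow> int" where
  "act_U i m z =
     (if z = i then i + 1 else if z = i + 1 then i
      else if m z = i then m (i + 1) else if m z = i + 1 then m i else m z)"

text \<open>A preimage of \<open>m\<close> under \<open>act_U i\<close> when
  \<open>{i, i + 1}\<close> is a cup: the edge \<open>{u, m u}\<close> is cut and its ends are tied
  to \<open>i\<close> and \<open>i + 1\<close>. Every \<open>u\<close> off the cup gives one, and
  this freedom is what \<open>descent_at_cup\<close> exploits.\<close>

definition uncap :: "int \<Rightarrow> int \<Rightarrow> (int \<Rightarrow> int) \<Rightarrow> int \<Rightarrow> int" where
  "uncap i u m z =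
     (if z = i then u else if z = u then i
      else if z = i + 1 then m u else if z = m u then i + 1 else m z)"

lemma matching_uncap:
  assumes m: "matching N m" and i: "0 < i" "i < int N" and cup: "m i = i + 1"
    and u: "u \<in> points N" "u \<notin> {i, i + 1}"
  shows "matching N (uncap i u m)"
    and "\<And>z. z \<in> points N \<Longrightarrow> act_U i (uncap i u m) z = m z"
proof -
  have p: "i \<in> points N" "i + 1 \<in> points N" using i by (auto simp: points_def)
  have cup': "m (i + 1) = i" using matchingD[OF m p(1)] cup by simp
  have v: "m u \<in> points N" "m u \<noteq> u" "m (m u) = u" using matchingD[OF m u(1)] by auto
  have v': "m u \<noteq> i" "m u \<noteq> i + 1" using v u cup cup' by auto
  have z: "m z \<in> points N \<and> m z \<noteq> z \<and> m (m z) = z \<and> m z \<notin> {i, i + 1, u, m u}"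
    if "z \<in> points N" "z \<notin> {i, i + 1, u, m u}" for z
  proof -
    have "m (m z) = z" using matchingD[OF m that(1)] by simp
    then show ?thesis using matchingD[OF m that(1)] that v cup cup' by auto
  qed
  show "matching N (uncap i u m)"
    unfolding matching_def
  proof
    fix x assume "x \<in> points N"
    then show "uncap i u m x \<in> points N \<and> uncap i u m x \<noteq> x \<and> uncap i u m (uncap i u m x) = x"
      using p u v v' z[of x] by (cases "x \<in> {i, i + 1, u, m u}") (auto simp: uncap_def)
  qed
  show "act_U i (uncap i u m) x = m x" if "x \<in> points N" for x
  proof -
    have vals: "uncap i u m i = u" "uncap i u m (i + 1) = m u" "uncap i u m u = i" 
      "uncap i u m (m u) = i + 1"
      using u v v' by (auto simp: uncap_def)
    consider "x = i" | "x = i + 1" | "x = u" | "x = m u" | "x \<notin> {i, i + 1, u, m u}" by blast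
    then show ?thesis
    proof cases
      case 5
      then have "uncap i u m x = m x" by (simp add: uncap_def)
      then show ?thesis using z[OF that 5] 5 by (simp add: act_U_def)
    qed (use vals u v v' cup cup' in \<open>simp_all add: act_U_def\<close>)
  qed
qed

text \<open>The premise \<open>other\<close> excludes a through edge that crosses both new edges but not the old one.\<close>

lemma U_move:
  assumes m: "matching N m" and i: "0 < i" "i < int N" and cup: "m i = i + 1"
    and u: "u \<in> points N" "u \<notin> {i, i + 1}" and wide: "\<bar>u\<bar> \<le> i" "i < \<bar>m u\<bar>"
    and e1: "crossings N (uncap i u m) i \<le> width (uncap i u m) i"
    and e2: "crossings N (uncap i u m) (i + 1) \<le> width (uncap i u m) (i + 1)"
    and other: "\<And>s. s \<in> points N \<Longrightarrow> 0 < s \<Longrightarrow> m s < 0 \<Longrightarrow> s \<notin> {i, i + 1, u, m u} \<Longrightarrow>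
        between s i (m s) \<noteq> between s u (m s) \<Longrightarrow> between s u (m s) = between s (m u) (m s) \<Longrightarrow> False"
  shows "total_weight N (uncap i u m) + 4 \<le> total_weight N m"
proof -
  let ?m = "uncap i u m" and ?j = "i + 1"
  define v where "v = m u"
  let ?Q = "{i, ?j, u, v}"
  have p: "i \<in> points N" "?j \<in> points N" using i by (auto simp: points_def)
  have m': "matching N ?m" using matching_uncap[OF m i cup u] by simp
  have cup': "m ?j = i" using matchingD[OF m p(1)] cup by simp
  have v: "v \<in> points N" "v \<noteq> u" "m v = u" using matchingD[OF m u(1)] by (auto simp: v_def)
  have v': "v \<noteq> i" "v \<noteq> ?j" using v u cup cup' by auto
  have vals: "?m i = u" "?m u = i" "?m ?j = v" "?m v = ?j"
    using u v v' by (auto simp: uncap_def v_def)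
  have z: "m z \<notin> ?Q" "m (m z) = z" "?m z = m z"
    if "z \<in> points N" "z \<notin> ?Q" for z
  proof -
    show "m (m z) = z" using matchingD[OF m that(1)] by simp
    then show "m z \<notin> ?Q" using that v cup cup' by (auto simp: v_def)
    show "?m z = m z" using that by (auto simp: uncap_def v_def)
  qed
  have rest: "weight N ?m x \<le> weight N m x" if x: "x \<in> points N" "x \<notin> ?Q" for x
  proof (cases "x * m x > 0")
    \<comment> \<open>Both ends lie in one row, so the new weight is the size, which has not
      changed.\<close>
    case True
    have eq: "width ?m x = width m x" using z[OF x] by (simp add: width_def)
    have "crossings N ?m x < width ?m x"
      using m' x True z[OF x] by (intro crossings_cup) auto
    then show ?thesis using eq by (simp add: weight_def)
  next
    case False
    have eq: "width ?m x = width m x" using z[OF x] by (simp add: width_def)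
    have mx: "m x \<in> points N" using m x by (simp add: matchingD)
    have nz: "x \<noteq> 0" "m x \<noteq> 0" using x mx by (auto simp: points_def)
    let ?b = "\<lambda>z. between x z (m x)"
    have ij: "?b i = ?b ?j"
    proof -
      have "i < y \<longleftrightarrow> ?j < y" "y < i \<longleftrightarrow> y < ?j" if "y \<noteq> i" "y \<noteq> ?j" for y
        using that by linarith+
      then show ?thesis using x(2) z(1)[OF x] by (simp add: between_def)
    qed
    have key: "?b u \<noteq> ?b v \<or> ?b i = ?b u"
    proof (cases "x > 0")
      case True
      then show ?thesis
        using other[OF x(1)] x False nz by (auto simp: zero_less_mult_iff v_def)
    next
      case neg: False
      then have "0 < m x" "x < 0" using False nz by (auto simp: zero_less_mult_iff)
      then show ?thesis
        using other[OF mx] x z[OF x] False nz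
        by (auto simp: zero_less_mult_iff v_def between_commute[of "m x"])
    qed
    have sub: "w \<in> crossers N m x" if "w \<in> crossers N ?m x" "w \<notin> ?Q" for w
      using that z[of w] z[OF x] by (auto simp: crossers_def)
    have "card (crossers N ?m x) \<le> card (crossers N m x)"
    proof (cases "?b u = ?b v")
      \<comment> \<open>By \<open>key\<close>, an edge that does not cross the removed edge crosses
        neither of the new ones.\<close>
      case True
      then have "w \<notin> ?Q" if "w \<in> crossers N ?m x" for w
        using that key ij vals z[OF x] by (auto simp: crossers_def)
      then have "crossers N ?m x \<subseteq> crossers N m x" using sub by blast
      then show ?thesis by (simp add: card_mono)
    next
      \<comment> \<open>An edge that separates \<open>u\<close> from \<open>v\<close> has
        \<open>i\<close> and \<open>i + 1\<close> on the same side, hence crosses exactly one of the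
        two new edges: one crosser is exchanged for another.\<close>
      case F: False
      have uv: "u \<in> crossers N m x" "v \<in> crossers N m x"
        using F u v by (auto simp: crossers_def v_def)
      obtain y k where yk: "y \<in> {u, v}" "crossers N ?m x \<subseteq> insert k (crossers N m x - {y})"
      proof (cases "?b i = ?b u")
        case True
        have "crossers N ?m x \<subseteq> insert ?j (crossers N m x - {u})"
        proof
          fix w assume w: "w \<in> crossers N ?m x"
          then have "w \<noteq> i" "w \<noteq> u" using True vals z[OF x] by (auto simp: crossers_def)
          then show "w \<in> insert ?j (crossers N m x - {u})"
            using sub[OF w] uv v by auto
        qed
        then show ?thesis using that by blast
      next
        case False
        then have *: "?b ?j = ?b v" using F ij by auto
        have "crossers N ?m x \<subseteq> insert i (crossers N m x - {v})"
        proof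
          fix w assume w: "w \<in> crossers N ?m x"
          then have "w \<noteq> ?j" "w \<noteq> v" using * vals z[OF x] by (auto simp: crossers_def)
          then show "w \<in> insert i (crossers N m x - {v})"
            using sub[OF w] uv v by auto
        qed
        then show ?thesis using that by blast
      qed
      have "card (crossers N ?m x) \<le> card (insert k (crossers N m x - {y}))"
        using yk(2) by (rule card_mono[rotated]) simp
      also have "\<dots> \<le> Suc (card (crossers N m x - {y}))" by (rule card_insert_le_m1) simp_all
      also have "\<dots> = card (crossers N m x)"
        using yk(1) uv by (intro card_Suc_Diff1) auto
      finally show ?thesis .
    qed
    then have "crossings N ?m x \<le> crossings N m x" by (simp add: card_crossers m m')
    then show ?thesis using eq by (simp add: weight_def)
  qed
  have Q: "?Q \<subseteq> points N" "card ?Q = 4" using p u v v' by (auto simp: card_insert_if)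
  have sumQ: "sum f ?Q = f i + f ?j + f u + f v" for f :: "int \<Rightarrow> nat"
    using u v v' by (simp add: add.assoc)
  have pu: "weight N ?m u = weight N ?m i" using weight_partner[OF m' p(1)] vals by simp
  have pv: "weight N ?m v = weight N ?m ?j" using weight_partner[OF m' p(2)] vals by simp
  \<comment> \<open>The new edges weigh \<open>i - \<bar>u\<bar>\<close> and
    \<open>\<bar>v\<bar> - i - 1\<close>, together one less than the lower bound
    \<open>\<bar>v\<bar> - \<bar>u\<bar>\<close> for the removed edge; the cup weighs at least one
    more. The saving of 2 counts at both ends of the edges.\<close>
  have w1: "int (weight N ?m i) = i - \<bar>u\<bar>"
    using e1 vals i wide by (simp add: weight_def width_def)
  have w2: "int (weight N ?m ?j) = \<bar>v\<bar> - i - 1"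
    using e2 vals i wide by (simp add: weight_def width_def v_def)
  have "1 \<le> width m i" "1 \<le> width m ?j" using i cup cup' by (simp_all add: width_def)
  then have w3: "1 \<le> weight N m i" "1 \<le> weight N m ?j" by (simp_all add: weight_def)
  have "\<bar>v\<bar> - \<bar>u\<bar> \<le> int (width m u)" "\<bar>v\<bar> - \<bar>u\<bar> \<le> int (width m v)"
    using wide v by (simp_all add: width_def v_def)
  then have w4: "\<bar>v\<bar> - \<bar>u\<bar> \<le> int (weight N m u)" "\<bar>v\<bar> - \<bar>u\<bar> \<le> int (weight N m v)"
    by (simp_all add: weight_def)
  have "sum (weight N ?m) ?Q + 4 \<le> sum (weight N m) ?Q"
    unfolding sumQ pu pv using w1 w2 w3 w4 by linarith
  moreover have "sum (weight N ?m) (points N - ?Q) \<le> sum (weight N m) (points N - ?Q)"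
    by (rule sum_mono) (use rest in auto)
  ultimately show ?thesis
    using sum.subset_diff[OF Q(1) finite_points, of "weight N ?m"]
      sum.subset_diff[OF Q(1) finite_points, of "weight N m"]
    unfolding total_weight_def by linarith
qed


subsection \<open>Descent\<close>

text \<open>The right end of an upper cup would go left, so every upper node has a lower partner, in
  its own column or further right. The columns are then settled from right to left, each finding all
  those beyond it taken.\<close>

lemma no_leftgoing_straight:
  assumes m: "matching N m" and ge: "\<And>s. 0 < s \<Longrightarrow> s \<le> int N \<Longrightarrow> s \<le> \<bar>m s\<bar>"
    and z: "z \<in> points N"
  shows "m z = - z"
proof -
  have pts: "s \<in> points N" if "0 < s" "s \<le> int N" for s using that by (auto simp: points_def)
  have neg: "m s < 0" if s: "0 < s" "s \<le> int N" for s
  proof (rule ccontr)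
    assume "\<not> m s < 0"
    then have "0 < m s" "m s \<le> int N" using matchingD(1)[OF m pts[OF s]] by (auto simp: points_def)
    then have "s = m s" using ge[OF s] ge[of "m s"] s matchingD(3)[OF m pts[OF s]] by simp
    then show False using matchingD(2)[OF m pts[OF s]] by simp
  qed
  have up: "0 < s \<Longrightarrow> s \<le> int N \<Longrightarrow> m s = - s" for s
  proof (induction "nat (int N - s)" arbitrary: s rule: less_induct)
    case less
    have r: "s \<le> - m s" "- m s \<le> int N"
      using ge[OF less.prems] neg[OF less.prems] matchingD(1)[OF m pts[OF less.prems]]
      by (auto simp: points_def)
    show ?case
    proof (rule ccontr)
      assume "m s \<noteq> - s"
      then have "s < - m s" using r by simp
      then have "m (- m s) = m s" using less.hyps[of "- m s"] less.prems r by simp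
      then have "- m s = s"
        using matching_eq_iff(1)[OF m] pts[of "- m s"] pts[OF less.prems] less.prems r by simp
      then show False using \<open>m s \<noteq> - s\<close> by simp
    qed
  qed
  show ?thesis
  proof (cases "0 < z")
    case True then show ?thesis using up z by (auto simp: points_def)
  next
    case False
    then have "m (- z) = z" using up[of "- z"] z by (auto simp: points_def)
    moreover have "- z \<in> points N" using z by (simp add: points_def)
    ultimately show ?thesis using matchingD(3)[OF m] by metis
  qed
qed

lemma cup_crossings_le_width:
  "matching N m \<Longrightarrow> x \<in> points N \<Longrightarrow> 0 < x \<Longrightarrow> 0 < m x \<Longrightarrow> crossings N m x \<le> width m x"
  by (rule less_imp_le, rule crossings_cup) simp_all

text \<open>
  Some edge \<open>f = {u, m u}\<close> spans the columns of the cup \<open>{i, i + 1}\<close>, and both can be replaced by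
  the two edges joining \<open>i\<close> and \<open>i + 1\<close> to the ends of \<open>f\<close>. The choice of \<open>f\<close> matters: an edge of
  weight \<open>cr\<close> crossing both new edges but not \<open>f\<close> would become heavier.
\<close>

lemma descent_at_cup:
  assumes m: "matching N m" and i: "0 < i" "i < int N" and cup: "m i = i + 1"
    and ge: "\<And>s. 0 < s \<Longrightarrow> s \<le> i \<Longrightarrow> s \<le> \<bar>m s\<bar>"
  shows "\<exists>u. u \<in> points N \<and> u \<notin> {i, i + 1} \<and> total_weight N (uncap i u m) + 4 \<le> total_weight N m"
proof -
  let ?j = "i + 1"
  have p: "i \<in> points N" "?j \<in> points N" using i by (auto simp: points_def)
  have cup': "m ?j = i" using matchingD[OF m p(1)] cup by simp
  have up: "s \<in> points N" if "s \<in> {1..<i}" for s using that i by (auto simp: points_def)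
  have low: "- s \<in> points N" if "s \<in> {1..i}" for s using that i by (auto simp: points_def)
  have mm: "m (m s) = s" "m s \<in> points N" "m s \<noteq> s" if "s \<in> points N" for s
    using matchingD[OF m that] by auto
  note move = U_move[OF m i cup]
  show ?thesis
  proof (cases "\<exists>s\<in>{1..<i}. 0 < m s")
    case True
    \<comment> \<open>A cup that starts left of \<open>i\<close> ends right of \<open>i + 1\<close>,
      since \<open>ge\<close> forbids leftgoing ends up to \<open>i\<close>. Both new edges are cups
      again, so their sizes dominate.\<close>
    then obtain s where s: "s \<in> {1..<i}" "0 < m s" by blast
    note ms = mm[OF up[OF s(1)]]
    have "m s \<noteq> i" "m s \<noteq> ?j" using ms s cup cup' by auto
    moreover have "\<not> m s < i"
      using ge[of s] ge[of "m s"] ms s by auto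
    ultimately have wide: "?j < m s" by simp
    have u: "s \<notin> {i, ?j}" using s by auto
    have m': "matching N (uncap i s m)" using matching_uncap[OF m i cup up[OF s(1)] u] by simp
    have vals: "uncap i s m i = s" "uncap i s m ?j = m s" using s by (auto simp: uncap_def)
    have "total_weight N (uncap i s m) + 4 \<le> total_weight N m"
      by (rule move[OF up[OF s(1)] u])
        (use s wide i p vals m' in \<open>auto intro!: cup_crossings_le_width simp: between_def\<close>)
    then show ?thesis using up[OF s(1)] u by blast
  next
    case False
    then have through: "m s < 0" if "s \<in> {1..<i}" for s
      using that mm(2)[OF up[OF that]] by (auto simp: points_def not_less le_less)
    \<comment> \<open>\<open>q\<close> is the least lower column not joined to an upper node left of the cup.\<close>
    have "\<exists>t. 0 < t \<and> int t \<le> i \<and> m (- int t) \<notin> {1..<i}"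
    proof (rule ccontr)
      assume *: "\<not> ?thesis"
      \<comment> \<open>Otherwise the \<open>i\<close> lower nodes up to column \<open>i\<close>
        would have their partners among only \<open>i - 1\<close> upper nodes.\<close>
      have "m (- t) \<in> {1..<i}" if "t \<in> {1..i}" for t
        using *[simplified, rule_format, of "nat t"] that by auto
      then have "(\<lambda>t. m (- t)) ` {1..i} \<subseteq> {1..<i}" by blast
      moreover have "inj_on (\<lambda>t. m (- t)) {1..i}"
        by (rule inj_onI) (use low matching_eq_iff(1)[OF m] in fastforce)
      ultimately have "card {1..i} \<le> card {1..<i}" by (intro card_inj_on_le) auto
      then show False using i by simp
    qed
    then obtain t0 where t0: "0 < t0 \<and> int t0 \<le> i \<and> m (- int t0) \<notin> {1..<i}"
      and least: "\<And>t. t < t0 \<Longrightarrow> \<not> (0 < t \<and> int t \<le> i \<and> m (- int t) \<notin> {1..<i})"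
      unfolding exists_least_iff[of "\<lambda>t. 0 < t \<and> int t \<le> i \<and> m (- int t) \<notin> {1..<i}"] by blast
    define q where "q = int t0"
    have q: "0 < q" "q \<le> i" "m (- q) \<notin> {1..<i}" using t0 by (auto simp: q_def)
    have lq: "m (- t) \<in> {1..<i}" if "0 < t" "t < q" for t
      using least[of "nat t"] that q by (auto simp: q_def)
    have qp: "- q \<in> points N" using q i by (auto simp: points_def)
    note mq = mm[OF qp]
    have mqij: "m (- q) \<notin> {i, ?j}" using mq cup cup' q i by force
    have qu: "- q \<notin> {i, ?j}" using q i by auto
    \<comment> \<open>Of the \<open>i + q - 2\<close> nodes inside an edge from \<open>i\<close> to
      \<open>- q\<close>, the lower nodes left of \<open>q\<close> and their upper partners make up
      twice \<open>q - 1\<close>, so at most \<open>i - q\<close> crossings remain.\<close>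
    have e1: "crossings N m' i \<le> width m' i"
      if m': "matching N m'" and "m' i = - q" and eq: "\<And>t. 0 < t \<Longrightarrow> t < q \<Longrightarrow> m' (- t) = m (- t)"
      for m'
    proof -
      let ?A = "{- (q - 1)..- 1}"
      have A: "m' z = m z" "m z \<in> {1..<i}" "m' (m z) = z" "z \<in> points N" if "z \<in> ?A" for z
      proof -
        show "m' z = m z" "m z \<in> {1..<i}" using eq[of "- z"] lq[of "- z"] that by auto
        show "z \<in> points N" using that i q by (auto simp: points_def)
        then show "m' (m z) = z" using matchingD(3)[OF m'] \<open>m' z = m z\<close> by metis
      qed
      have "inj_on m ?A" by (rule inj_onI) (use A(4) matching_eq_iff(1)[OF m] in auto)
      moreover have "?A \<inter> m ` ?A = {}" using A(2) by force
      ultimately have "card (?A \<union> m ` ?A) = 2 * nat (q - 1)"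
        by (simp add: card_Un_disjoint card_image)
      moreover have "int (crossings N m' i) + int (card (?A \<union> m ` ?A)) \<le> i - m' i - 2"
      proof (rule crossings_through)
        fix z assume "z \<in> ?A \<union> m ` ?A"
        then consider "z \<in> ?A" | w where "w \<in> ?A" "z = m w" by blast
        then show "m' i < z \<and> z < i \<and> z \<noteq> 0 \<and> m' i < m' z \<and> m' z < i"
        proof cases
          case 1
          then show ?thesis using A(1,2)[OF 1] that(2) q i by auto
        next
          case 2
          then show ?thesis using A(2,3)[OF 2(1)] that(2) q i by auto
        qed
      qed (use that(2) q i in auto)
      ultimately show ?thesis using that(2) q i by (simp add: width_def)
    qed
    \<comment> \<open>The lower nodes left of \<open>q\<close> are all joined to upper nodes left of
      \<open>i\<close>.\<close>
    have noq: "\<not> (i < s \<and> - q < m s)" 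
      if "0 < s" "m s < 0" "s \<in> points N" for s
      using lq[of "- m s"] that mm(1)[OF that(3)] by auto
    show ?thesis
    proof (cases "0 < m (- q)")
      \<comment> \<open>A through edge from \<open>- q\<close> to the right of the cup is split into
        a through edge at \<open>i\<close> and a cup at \<open>i + 1\<close>.\<close>
      case True
      then have wide: "?j < m (- q)" using q(3) mqij by auto
      let ?m = "uncap i (- q) m"
      have m': "matching N ?m" using matching_uncap[OF m i cup qp qu] by simp
      have vals: "?m i = - q" "?m ?j = m (- q)" using q i by (auto simp: uncap_def)
      have "total_weight N ?m + 4 \<le> total_weight N m"
      proof (rule move[OF qp qu])
        show "crossings N ?m i \<le> width ?m i"
          by (rule e1[OF m' vals(1)]) (use i q True in \<open>auto simp: uncap_def\<close>)
        show "crossings N ?m ?j \<le> width ?m ?j"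
          by (rule cup_crossings_le_width) (use m' p i vals wide in auto)
        fix s assume s: "s \<in> points N" "0 < s" "m s < 0" "s \<notin> {i, i + 1, - q, m (- q)}"
         "between s i (m s) \<noteq> between s (- q) (m s)"
         "between s (- q) (m s) = between s (m (- q)) (m s)"
        then have "m s \<noteq> - q" using mm(1)[of s] by auto
        then show False using noq[of s] s wide q i by (auto simp: between_def)
      qed (use q wide in auto)
      then show ?thesis using qp qu by blast
    next
      case neg: False
      define v where "v = - m (- q)"
      have v: "0 < v" "- v \<in> points N" "m (- q) = - v" "m (- v) = - q" "v \<noteq> q"
        using neg mq by (auto simp: v_def points_def)
      have qv: "q < v"
        using lq[of v] v q by (cases v q rule: linorder_cases) auto
      show ?thesis
      \<comment> \<open>Now the edge at \<open>- q\<close> joins two lower nodes. It can be split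
        only if it reaches beyond \<open>i\<close>, as \<open>wide\<close> in \<open>U_move\<close>
        demands, and if no edge from the left of \<open>i\<close> lands beyond \<open>v\<close>:
        such an edge would cross both new edges but not the old one.\<close>
      proof (cases "i < v \<and> (\<forall>s\<in>{1..<i}. - m s < v)")
        case True
        let ?m = "uncap i (- q) m"
        have m': "matching N ?m" using matching_uncap[OF m i cup qp qu] by simp
        have vals: "?m i = - q" "?m ?j = - v" using q i v by (auto simp: uncap_def)
        have up': "?m s = m s" if "s \<in> {1..<i}" for s
          using that i q v by (auto simp: uncap_def)
        have "total_weight N ?m + 4 \<le> total_weight N m"
        proof (rule move[OF qp qu])
          show "crossings N ?m i \<le> width ?m i"
            by (rule e1[OF m' vals(1)]) (use i q qv v in \<open>auto simp: uncap_def\<close>)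
          \<comment> \<open>The upper nodes up to \<open>i\<close> have all their partners inside
            the edge from \<open>i + 1\<close> to \<open>- v\<close>. Of its
            \<open>i + v - 1\<close> inner nodes, twice \<open>i\<close> are thus enclosed, leaving
            at most \<open>v - i - 1\<close> crossings, its size.\<close>
          let ?A = "{1..i}"
          have A: "z \<in> points N" "- v < ?m z" "?m z < 0" "?m (?m z) = z" if "z \<in> ?A" for z
          proof -
            show z: "z \<in> points N" using that i by (auto simp: points_def)
            show "?m (?m z) = z" using matchingD(3)[OF m' z] .
            show "- v < ?m z" "?m z < 0"
              using that up'[of z] through[of z] vals True q qv
              by (cases "z = i"; force)+
          qed
          have "inj_on ?m ?A" by (rule inj_onI) (use A(1) matching_eq_iff(1)[OF m'] in auto)
          then have "card (?A \<union> ?m ` ?A) = 2 * nat i"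
            using A(3) by (subst card_Un_disjoint) (force simp: card_image)+
          moreover have "int (crossings N ?m ?j) + int (card (?A \<union> ?m ` ?A)) \<le> ?j - ?m ?j - 2"
            by (rule crossings_through) (use A vals v i in fastforce)+
          ultimately show "crossings N ?m ?j \<le> width ?m ?j" using vals True i by (simp add: width_def)
          fix s assume s: "s \<in> points N" "0 < s" "m s < 0" "s \<notin> {i, i + 1, - q, m (- q)}"
           "between s i (m s) \<noteq> between s (- q) (m s)"
           "between s (- q) (m s) = between s (m (- q)) (m s)"
          have "s < i \<Longrightarrow> - m s < v" using True s by auto
          moreover have "m s \<noteq> - q" "m s \<noteq> - v" using s mm(1)[of s] v by auto
          ultimately show False using noq[of s] q i s v by (auto simp: between_def)
        qed (use q v True in auto)
        then show ?thesis using qp qu by blast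
      next
        case no: False
        have "\<exists>s\<in>{1..<i}. i < - m s \<and> v < - m s"
        proof (cases "i < v")
          case True
          then obtain s where s: "s \<in> {1..<i}" "v \<le> - m s" using no by force
          then have "- m s \<noteq> v" using v(4) mm(1)[OF up[OF s(1)]] q by auto
          then show ?thesis using s True by force
        next
          case False
          \<comment> \<open>The \<open>i - 1\<close> edges from the left of \<open>i\<close> cannot
            all land in the first \<open>i\<close> columns, two of which, \<open>q\<close> and
            \<open>v\<close>, are taken.\<close>
          have "\<not> (\<forall>s\<in>{1..<i}. - m s \<le> i)"
          proof
            assume *: "\<forall>s\<in>{1..<i}. - m s \<le> i"
            have "(\<lambda>s. - m s) ` {1..<i} \<subseteq> {1..i} - {q, v}"
            proof
              fix c assume "c \<in> (\<lambda>s. - m s) ` {1..<i}"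
              then obtain s where s: "s \<in> {1..<i}" "c = - m s" by blast
              then have "m (- c) = s" using mm(1)[OF up[OF s(1)]] by simp
              then have "c \<noteq> q" "c \<noteq> v" using v s q by auto
              then show "c \<in> {1..i} - {q, v}" using s * through[OF s(1)] by auto
            qed
            moreover have "inj_on (\<lambda>s. - m s) {1..<i}"
              by (rule inj_onI) (use up matching_eq_iff(1)[OF m] in fastforce)
            ultimately have "card {1..<i} \<le> card ({1..i} - {q, v})"
              by (intro card_inj_on_le) auto
            also have "\<dots> = nat i - 2"
              using False q v by (subst card_Diff_subset) auto
            finally show False using q qv False by simp
          qed
          then show ?thesis using False by force
        qed
        then obtain s0 where s0: "s0 \<in> {1..<i}" "i < - m s0" "v < - m s0" by blast
        \<comment> \<open>The edge with the rightmost landing is split, so that no other through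
          edge can cross both new edges without crossing it.\<close>
        have "Max ((\<lambda>s. - m s) ` {1..<i}) \<in> (\<lambda>s. - m s) ` {1..<i}"
          using s0(1) by (intro Max_in) auto
        then obtain u where u: "u \<in> {1..<i}" "Max ((\<lambda>s. - m s) ` {1..<i}) = - m u" by blast
        have umax: "- m s \<le> - m u" if "s \<in> {1..<i}" for s
          using that unfolding u(2)[symmetric] by (intro Max_ge) auto
        have M: "i < - m u" "v < - m u" using umax[OF s0(1)] s0 by auto
        have uij: "u \<notin> {i, ?j}" using u by auto
        let ?m = "uncap i u m"
        have m': "matching N ?m" using matching_uncap[OF m i cup up[OF u(1)] uij] by simp
        have vals: "?m i = u" "?m u = i" "?m ?j = m u" "?m (- q) = - v" "?m (- v) = - q"
          using u q v i M by (auto simp: uncap_def)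
        have up': "?m s = m s" "m u < m s" if "s \<in> {1..<i} - {u}" for s
        proof -
          have "m s \<noteq> m u" using that u(1) up matching_eq_iff(1)[OF m] by auto
          then show "m u < m s" using umax[of s] that by auto
          show "?m s = m s" using that through[OF u(1)] by (auto simp: uncap_def)
        qed
        have "total_weight N ?m + 4 \<le> total_weight N m"
        proof (rule move[OF up[OF u(1)] uij])
          show "crossings N ?m i \<le> width ?m i"
            by (rule cup_crossings_le_width) (use m' p i vals u in auto)
          let ?B = "{1..<i} - {u}"
          \<comment> \<open>Enclosed by the edge from \<open>i + 1\<close> to \<open>m u\<close> are
            \<open>i\<close> upper nodes, the lower ends of the \<open>i - 2\<close> untouched edges
            starting there, and the lower nodes of columns \<open>q\<close> and \<open>v\<close>:
            again twice \<open>i\<close>.\<close>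
          let ?S = "{1..i} \<union> (m ` ?B \<union> {- q, - v})"
          have inj: "inj_on m ?B"
            by (rule inj_onI) (use up matching_eq_iff(1)[OF m] in auto)
          have B: "m z \<noteq> - q" "m z \<noteq> - v" "m z < 0" if "z \<in> ?B" for z
            using that v mm(1)[OF up, of z] through[of z] q by auto
          then have "m z \<notin> {- q, - v}" if "z \<in> ?B" for z using that by simp
          then have "m ` ?B \<inter> {- q, - v} = {}" by blast
          then have "card (m ` ?B \<union> {- q, - v}) = card (m ` ?B) + card {- q, - v}"
            by (intro card_Un_disjoint) simp_all
          also have "card {- q, - v} = 2" using v by simp
          also have "card (m ` ?B) = nat (i - 2)"
            using u by (simp add: card_image[OF inj] card_Diff_singleton nat_diff_distrib)
          also have "nat (i - 2) + 2 = nat i" using u by auto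
          finally have c: "card (m ` ?B \<union> {- q, - v}) = nat i" .
          have neg: "z < 0" if "z \<in> m ` ?B \<union> {- q, - v}" for z
            using that B(3) v(1) q(1) by (elim UnE imageE) (simp, auto)
          have "z \<notin> {1..i}" if "z \<in> m ` ?B \<union> {- q, - v}" for z
            using neg[OF that] by simp
          then have "{1..i} \<inter> (m ` ?B \<union> {- q, - v}) = {}" by blast
          then have "card ?S = 2 * nat i"
            using card_Un_disjoint[of "{1..i}" "m ` ?B \<union> {- q, - v}"] c by simp
          moreover have "int (crossings N ?m ?j) + int (card ?S) \<le> ?j - ?m ?j - 2"
          proof (rule crossings_through)
            fix z assume "z \<in> ?S"
            then consider "z = i" | "z = u" | "z \<in> ?B" | s where "s \<in> ?B" "z = m s" | "z = - q" | "z = - v"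
              by force
            then show "?m ?j < z \<and> z < ?j \<and> z \<noteq> 0 \<and> ?m ?j < ?m z \<and> ?m z < ?j"
            proof cases
              case 3 then show ?thesis using vals M up'[of z] through[of z] i by auto
            next
              case 4
              then have "?m z = s" using up'(1)[OF 4(1)] matchingD(3)[OF m' up[of s]] by auto
              then show ?thesis using 4 vals M up'[OF 4(1)] through[of s] i by auto
            qed (use vals M u q v qv i in auto)
          qed (use vals M i in auto)
          ultimately show "crossings N ?m ?j \<le> width ?m ?j" using vals M i by (simp add: width_def)
          fix s assume s: "s \<in> points N" "0 < s" "m s < 0" "s \<notin> {i, i + 1, u, m u}"
           "between s i (m s) \<noteq> between s u (m s)"
           "between s u (m s) = between s (m u) (m s)"
          have "s < i \<Longrightarrow> m u < m s" using up'(2)[of s] s by auto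
          then show False using s u M i by (auto simp: between_def)
        qed (use u M in auto)
        then show ?thesis using up[OF u(1)] uij by blast
      qed
    qed
  qed
qed

lemma descent:
  assumes m: "matching N m" and ne: "\<not> (\<forall>z\<in>points N. m z = - z)"
  obtains i m' where "0 < i" "i < int N" "matching N m'" "total_weight N m' + 4 \<le> total_weight N m"
    "(\<forall>z\<in>points N. m z = act_T i m' z) \<or> (\<forall>z\<in>points N. m z = act_U i m' z)"
proof -
  \<comment> \<open>The leftmost upper node joined to a column further left either ends a cup of two
    adjacent nodes or lies on an edge crossing that of its left neighbour.\<close>
  have "\<exists>s. 0 < s \<and> s \<le> N \<and> \<bar>m (int s)\<bar> < int s"
  proof (rule ccontr)
    assume *: "\<not> ?thesis"
    have "s \<le> \<bar>m s\<bar>" if "0 < s" "s \<le> int N" for s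
      using *[simplified, rule_format, of "nat s"] that by (auto simp: nat_le_iff)
    then show False using ne no_leftgoing_straight[OF m] by blast
  qed
  then obtain s where s: "0 < s \<and> s \<le> N \<and> \<bar>m (int s)\<bar> < int s"
    and least: "\<And>t. t < s \<Longrightarrow> \<not> (0 < t \<and> t \<le> N \<and> \<bar>m (int t)\<bar> < int t)"
    unfolding exists_least_iff[of "\<lambda>s. 0 < s \<and> s \<le> N \<and> \<bar>m (int s)\<bar> < int s"] by blast
  define i where "i = int s - 1"
  have j: "i + 1 = int s" by (simp add: i_def)
  have "int s \<in> points N" using s by (auto simp: points_def)
  then have "m (int s) \<noteq> 0" using matchingD(1)[OF m] by (auto simp: points_def)
  \<comment> \<open>The partner column is positive and less than \<open>s\<close>, so
    \<open>s\<close> is at least 2.\<close>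
  then have i: "0 < i" "i < int N" using s by (auto simp: i_def)
  have ge: "t \<le> \<bar>m t\<bar>" if "0 < t" "t \<le> i" for t
    using least[of "nat t"] that i j by (auto simp: nat_less_iff)
  show thesis
  proof (cases "m i = i + 1")
    case False
    show thesis
      by (rule that[of i "act_T i m"])
        (use i s j m ge False in \<open>auto intro!: T_move matching_act_T\<close>)
  next
    case True
    obtain u where u: "u \<in> points N" "u \<notin> {i, i + 1}"
      "total_weight N (uncap i u m) + 4 \<le> total_weight N m"
      using descent_at_cup[OF m i True ge] by blast
    show thesis
      by (rule that[of i "uncap i u m"]) (use i u matching_uncap[OF m i True u(1,2)] in auto)
  qed
qed


subsection \<open>Uniqueness of traces\<close>

text \<open>\<open>trace\<close> between arbitrary positions of the stack instead of outer nodes, so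
  that paths can be cut, glued and pushed one level down.\<close>

fun run :: "tangle list \<Rightarrow> nat \<times> nat \<Rightarrow> strand list \<Rightarrow> nat \<times> nat \<Rightarrow> bool" where
  "run Xs u [] v \<longleftrightarrow> u = v"
| "run Xs u ((k, a, b) # ss) v \<longleftrightarrow> k < length Xs \<and> {a, b} \<in> Xs ! k \<and> position k a = u \<and>
     (ss \<noteq> [] \<longrightarrow> fst (hd ss) \<noteq> k) \<and> run Xs (position k b) ss v"

lemma run_iff:
  "run Xs u ss v \<longleftrightarrow> (\<forall>(k, a, b)\<in>set ss. k < length Xs \<and> {a, b} \<in> Xs ! k) \<and> successively linked ss \<and>
     (if ss = [] then u = v
      else (case hd ss of (k, a, b) \<Rightarrow> position k a = u) \<and>
           (case last ss of (k, a, b) \<Rightarrow> position k b = v))"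
  by (induction Xs u ss v rule: run.induct)
    (auto simp: successively_Cons linked_def split: prod.splits if_splits)

lemma trace_iff_run:
  "trace Xs x ss y \<longleftrightarrow> run Xs (outer_position (length Xs) x) ss (outer_position (length Xs) y)"
  by (simp add: trace_def run_iff)

lemma run_append:
  assumes "run Xs u s v" "run Xs v t w" "s \<noteq> [] \<Longrightarrow> t \<noteq> [] \<Longrightarrow> fst (last s) \<noteq> fst (hd t)"
  shows "run Xs u (s @ t) w"
  using assms by (induction Xs u s v rule: run.induct) (auto simp: hd_append split: if_splits)

lemma run_appendD:
  "run Xs u (s @ t) w \<Longrightarrow> \<exists>v. run Xs u s v \<and> run Xs v t w"
  by (induction Xs u s w rule: run.induct) (auto simp: hd_append split: if_splits)

definition reverse_strands :: "strand list \<Rightarrow> strand list" where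
  "reverse_strands ss = rev (map (\<lambda>(k, a, b). (k, b, a)) ss)"

lemma run_reverse: "run Xs u ss v \<Longrightarrow> run Xs v (reverse_strands ss) u"
proof (induction Xs u ss v rule: run.induct)
  case (2 Xs u k a b ss v)
  have "run Xs v (reverse_strands ss @ [(k, b, a)]) u"
  proof (rule run_append)
    show "run Xs v (reverse_strands ss) (position k b)" using 2 by simp
    show "run Xs (position k b) [(k, b, a)] u" using 2 by (simp add: insert_commute)
    assume "reverse_strands ss \<noteq> []"
    then show "fst (last (reverse_strands ss)) \<noteq> fst (hd [(k, b, a)])"
      using 2 by (cases ss) (auto simp: reverse_strands_def)
  qed
  then show ?case by (simp add: reverse_strands_def)
qed (simp add: reverse_strands_def)

fun deeper :: "nat \<times> 'a \<Rightarrow> nat \<times> 'a" where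
  "deeper (k, x) = (Suc k, x)"

lemma fst_deeper [simp]: "fst (deeper x) = Suc (fst x)" by (cases x) simp

lemma position_Suc: "position (Suc k) a = deeper (position k a)" by (cases a) auto

lemma run_deeper: "run Xs u ss v \<Longrightarrow> run (P # Xs) (deeper u) (map deeper ss) (deeper v)"
  by (induction Xs u ss v rule: run.induct) (auto simp: position_Suc hd_map)

text \<open>With an empty middle part, two consecutive strands would lie in the top tangle, which
  \<open>linked\<close> forbids; hence the last premise. Of \<open>t\<close> only the head is
  confined to the top tangle, so it may enter the lower stack again.\<close>

lemma run_sandwich:
  assumes "run (P # Xs) u s (deeper v)" "run Xs v l w" "run (P # Xs) (deeper w) t z"
    and "s \<noteq> [] \<Longrightarrow> fst (last s) = 0" "t \<noteq> [] \<Longrightarrow> fst (hd t) = 0" "l = [] \<Longrightarrow> s = [] \<or> t = []"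
  shows "run (P # Xs) u (s @ map deeper l @ t) z"
proof -
  have "run (P # Xs) (deeper v) (map deeper l @ t) z"
    using run_deeper[OF assms(2)] assms(3) by (rule run_append) (use assms(5) in \<open>auto simp: last_map\<close>)
  with assms(1) show ?thesis
    by (rule run_append) (use assms(4-6) in \<open>auto simp: hd_append hd_map\<close>)
qed

definition deterministic :: "tangle \<Rightarrow> bool" where
  "deterministic X \<longleftrightarrow> (\<forall>a b c. {a, b} \<in> X \<longrightarrow> {a, c} \<in> X \<longrightarrow> b = c)"

lemma fst_position: "fst (position k a) = k \<or> fst (position k a) = Suc k" by (cases a) auto

lemma position_inj: "position k a = position k b \<Longrightarrow> a = b" by (cases a; cases b) auto

text \<open>An interior level meets just two tangles, so a path arriving from tangle
  \<open>k\<close> can continue only in the other one; at an outer level it must stop. Arrival from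
  \<open>k\<close> is expressed by a first strand outside \<open>k\<close>.\<close>

lemma run_unique_aux:
  assumes det: "\<forall>X\<in>set Xs. deterministic X"
  shows "run Xs (position k b) s v \<Longrightarrow> run Xs (position k b) t w \<Longrightarrow> k < length Xs \<Longrightarrow>
    (s \<noteq> [] \<longrightarrow> fst (hd s) \<noteq> k) \<Longrightarrow> (t \<noteq> [] \<longrightarrow> fst (hd t) \<noteq> k) \<Longrightarrow>
    fst v \<in> {0, length Xs} \<Longrightarrow> fst w \<in> {0, length Xs} \<Longrightarrow> s = t \<and> v = w"
proof (induction s arbitrary: k b t)
  case Nil
  show ?case
  proof (cases t)
    case (Cons h t')
    obtain k' a' b' where h: "h = (k', a', b')" by (cases h)
    have "position k' a' = position k b" "k' \<noteq> k" "k' < length Xs" using Nil Cons h by auto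
    then show ?thesis
      using Nil fst_position[of k b] fst_position[of k' a'] by auto
  qed (use Nil in auto)
next
  case (Cons h s)
  obtain k1 a1 b1 where h: "h = (k1, a1, b1)" by (cases h)
  have 1: "position k1 a1 = position k b" "k1 \<noteq> k" "k1 < length Xs" "{a1, b1} \<in> Xs ! k1"
    using Cons.prems h by auto
  show ?case
  proof (cases t)
    case Nil
    then show ?thesis
      using 1 Cons.prems fst_position[of k b] fst_position[of k1 a1] by auto
  next
    case t: (Cons h' t')
    obtain k2 a2 b2 where h': "h' = (k2, a2, b2)" by (cases h')
    have 2: "position k2 a2 = position k b" "k2 \<noteq> k" "k2 < length Xs" "{a2, b2} \<in> Xs ! k2"
      using Cons.prems t h' by auto
    have k: "k1 = k2"
      using 1 2 fst_position[of k b] fst_position[of k1 a1] fst_position[of k2 a2] by auto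
    then have a: "a1 = a2" using 1 2 position_inj by metis
    have "deterministic (Xs ! k1)" using det 1 by simp
    then have b: "b1 = b2" using 1 2 k a unfolding deterministic_def by metis
    have "s = t' \<and> v = w"
      by (rule Cons.IH[of k1 b1]) (use Cons.prems t h h' k a b in auto)
    then show ?thesis using t h h' k a b by simp
  qed
qed

lemma fst_outer_position: "fst (outer_position n x) \<in> {0, n}" by (cases x) auto

lemma outer_position_inj: "n > 0 \<Longrightarrow> outer_position n x = outer_position n y \<Longrightarrow> x = y"
  by (cases x; cases y) auto

lemma position_outer_position:
  "k < n \<Longrightarrow> position k a = outer_position n x \<Longrightarrow> a = x \<and> k = (case x of Upper _ \<Rightarrow> 0 | Lower _ \<Rightarrow> n - 1)"
  by (cases a; cases x) auto

text \<open>The first strand lies in the only tangle that meets the outer level of \<open>x\<close>,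
  and from there on \<open>run_unique_aux\<close> applies. Distinct ends exclude the empty trace in
  a nonempty stack.\<close>

lemma trace_unique:
  assumes det: "\<forall>X\<in>set Xs. deterministic X"
    and s: "trace Xs x s y" "x \<noteq> y" and t: "trace Xs x t z" "x \<noteq> z"
  shows "s = t \<and> y = z"
proof (cases "Xs = []")
  case True
  have "s = []" "t = []" using s t True unfolding trace_def by (cases s; cases t; auto)+
  then show ?thesis using s t True unfolding trace_def by (cases x; cases y; cases z; auto)
next
  case False
  let ?o = "outer_position (length Xs)"
  have n: "0 < length Xs" using False by simp
  have r: "run Xs (?o x) s (?o y)" "run Xs (?o x) t (?o z)" using s t by (simp_all add: trace_iff_run)
  then have "s \<noteq> []" "t \<noteq> []" using s(2) t(2) outer_position_inj[OF n] by auto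
  then obtain k1 a1 b1 s' k2 a2 b2 t' where eq: "s = (k1, a1, b1) # s'" "t = (k2, a2, b2) # t'"
    by (metis neq_Nil_conv prod_cases3)
  have 1: "k1 < length Xs" "position k1 a1 = ?o x" "k2 < length Xs" "position k2 a2 = ?o x"
    "{a1, b1} \<in> Xs ! k1" "{a2, b2} \<in> Xs ! k2"
    using r eq by auto
  have k: "k1 = k2" "a1 = a2"
    using position_outer_position[OF 1(1,2)] position_outer_position[OF 1(3,4)] by auto
  have "deterministic (Xs ! k1)" using det 1 by simp
  then have b: "b1 = b2" using 1 k unfolding deterministic_def by metis
  have "s' = t' \<and> ?o y = ?o z"
    by (rule run_unique_aux[OF det, of k1 b1]) (use r eq k b fst_outer_position in auto)
  then show ?thesis using eq k b outer_position_inj[OF n] by simp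
qed

subsection \<open>Tangles as involutions\<close>

definition node_of :: "int \<Rightarrow> node" where
  "node_of z = (if z > 0 then Upper (nat z) else Lower (nat (- z)))"

definition tangle_of :: "nat \<Rightarrow> (int \<Rightarrow> int) \<Rightarrow> tangle" where
  "tangle_of N m = {{node_of x, node_of (m x)} | x. x \<in> points N}"

abbreviation outer :: "nat \<Rightarrow> int \<Rightarrow> nat \<times> nat" where
  "outer n x \<equiv> outer_position n (node_of x)"

lemma column_node_of [simp]: "column (node_of z) = nat \<bar>z\<bar>"
  by (simp add: node_of_def)

lemma node_of_inj: "x \<in> points N \<Longrightarrow> y \<in> points N \<Longrightarrow> node_of x = node_of y \<longleftrightarrow> x = y"
  by (auto simp: node_of_def points_def)

lemma node_ofE:
  assumes "v \<in> nodes N"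
  obtains x where "x \<in> points N" "v = node_of x"
proof (cases v)
  case (Upper c)
  then show thesis using assms by (intro that[of "int c"]) (auto simp: nodes_def points_def node_of_def)
next
  case (Lower c)
  then show thesis using assms by (intro that[of "- int c"]) (auto simp: nodes_def points_def node_of_def)
qed

lemma node_of_nodes: "x \<in> points N \<Longrightarrow> node_of x \<in> nodes N"
  by (cases "0 < x") (force simp: nodes_def points_def node_of_def)+

lemma tangle_of_cong:
  "(\<And>z. z \<in> points N \<Longrightarrow> m z = m' z) \<Longrightarrow> tangle_of N m = tangle_of N m'"
  unfolding tangle_of_def by force

lemma tangle_of_edge:
  assumes m: "matching N m" and x: "x \<in> points N" and e: "{node_of x, b} \<in> tangle_of N m"
  shows "b = node_of (m x)"
proof -
  obtain z where z: "z \<in> points N" "{node_of x, b} = {node_of z, node_of (m z)}"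
    using e by (auto simp: tangle_of_def)
  then consider "node_of x = node_of z" "b = node_of (m z)" | "node_of x = node_of (m z)" "b = node_of z"
    by (auto simp: doubleton_eq_iff)
  then show ?thesis using z x matchingD[OF m z(1)] by cases (auto simp: node_of_inj)
qed

lemma tangle_of_subset: "matching N m \<Longrightarrow> e \<in> tangle_of N m \<Longrightarrow> e \<subseteq> nodes N"
  by (auto simp: tangle_of_def matchingD node_of_nodes)

lemma deterministic_tangle_of:
  assumes m: "matching N m"
  shows "deterministic (tangle_of N m)"
  unfolding deterministic_def
proof (intro allI impI)
  fix a b c assume *: "{a, b} \<in> tangle_of N m" "{a, c} \<in> tangle_of N m"
  then have "a \<in> nodes N" using tangle_of_subset[OF m] by blast
  then show "b = c" using * tangle_of_edge[OF m] by (metis node_ofE)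
qed

lemma outer_eq_iff:
  assumes "x \<in> points N" "y \<in> points N" "outer n x = outer n y" "0 < x" "0 < y"
  shows "x = y"
  using assms by (auto simp: node_of_def points_def)


subsection \<open>Paths through a stack\<close>

definition realizes :: "nat \<Rightarrow> tangle list \<Rightarrow> (int \<Rightarrow> int) \<Rightarrow> (int \<Rightarrow> strand list) \<Rightarrow> bool" where
  "realizes N Xs m P \<longleftrightarrow>
     (\<forall>x\<in>points N. run Xs (outer (length Xs) x) (P x) (outer (length Xs) (m x)))"

lemma realizes_single:
  assumes "matching N m"
  shows "realizes N [tangle_of N m] m (\<lambda>x. [(0, node_of x, node_of (m x))])"
  unfolding realizes_def
proof
  fix x assume "x \<in> points N"
  then have "{node_of x, node_of (m x)} \<in> tangle_of N m" by (auto simp: tangle_of_def)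
  moreover have "position 0 (node_of y) = outer 1 y" for y by (simp add: node_of_def)
  ultimately show "run [tangle_of N m] (outer (length [tangle_of N m]) x) [(0, node_of x, node_of (m x))]
      (outer (length [tangle_of N m]) (m x))" by simp
qed

text \<open>Distinct outer nodes coincide only in the empty stack, and then they lie in opposite
  rows. So a path with both ends on top is never empty and can be extended by a top strand at each
  end.\<close>

lemma realizes_Nil:
  assumes m: "matching N m" and r: "realizes N Xs m P" and x: "x \<in> points N" and "P x = []"
  shows "x < 0 \<or> m x < 0"
proof (rule ccontr)
  assume "\<not> ?thesis"
  then have "0 < x" "0 < m x" using x matchingD(1)[OF m x] by (auto simp: points_def)
  moreover have "outer (length Xs) x = outer (length Xs) (m x)"
    using r x \<open>P x = []\<close> unfolding realizes_def by force
  ultimately show False using outer_eq_iff[OF x matchingD(1)[OF m x]] matchingD(2)[OF m x] by metis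
qed

text \<open>The strand of a new top tangle by which a path from an upper node comes down to column
  \<open>f x\<close> of the stack below; a path from a lower node needs none. \<open>f\<close> will
  be \<open>transp i\<close> or \<open>id\<close>.\<close>

definition enter :: "(int \<Rightarrow> int) \<Rightarrow> int \<Rightarrow> strand list" where
  "enter f x = (if 0 < x then [(0, node_of x, node_of (- f x))] else [])"

definition leave :: "(int \<Rightarrow> int) \<Rightarrow> int \<Rightarrow> strand list" where
  "leave f x = (if 0 < x then [(0, node_of (- f x), node_of x)] else [])"

lemma deeper_outer:
  "0 < x \<Longrightarrow> deeper (outer n x) = position 0 (node_of (- x))"
  "x < 0 \<Longrightarrow> deeper (outer n x) = outer (Suc n) x"
  by (simp_all add: node_of_def)

lemma run_enter_leave:
  assumes "x \<in> points N" "0 < x \<Longrightarrow> 0 < f x \<and> {node_of x, node_of (- f x)} \<in> P" "x < 0 \<Longrightarrow> f x = x"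
  shows "run (P # Xs) (outer (Suc n) x) (enter f x) (deeper (outer n (f x)))"
    and "run (P # Xs) (deeper (outer n (f x))) (leave f x) (outer (Suc n) x)"
proof -
  have "x < 0 \<or> 0 < x" using assms(1) by (auto simp: points_def)
  moreover have "position 0 (node_of x) = outer (Suc n) x" if "0 < x" using that by (simp add: node_of_def)
  ultimately show "run (P # Xs) (outer (Suc n) x) (enter f x) (deeper (outer n (f x)))"
    "run (P # Xs) (deeper (outer n (f x))) (leave f x) (outer (Suc n) x)"
    using assms(2,3) by (auto simp: enter_def leave_def deeper_outer insert_commute)
qed

lemma hd_enter_leave:
  "enter f x \<noteq> [] \<Longrightarrow> fst (last (enter f x)) = 0" "leave f x \<noteq> [] \<Longrightarrow> fst (hd (leave f x)) = 0"
  "enter f x = [] \<longleftrightarrow> x \<le> 0" "leave f x = [] \<longleftrightarrow> x \<le> 0"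
  by (auto simp: enter_def leave_def)

definition path_T :: "int \<Rightarrow> (int \<Rightarrow> strand list) \<Rightarrow> (int \<Rightarrow> int) \<Rightarrow> int \<Rightarrow> strand list" where
  "path_T i P m x =
     enter (transp i) x @ map deeper (P (transp i x)) @ leave (transp i) (act_T i m x)"

text \<open>In the second branch the path comes up from the stack at one of the columns
  \<open>i\<close> and \<open>i + 1\<close>, turns at the lower edge of the \<open>U\<close>-prime,
  and continues along the path that starts at the other column.\<close>

definition path_U :: "int \<Rightarrow> (int \<Rightarrow> strand list) \<Rightarrow> (int \<Rightarrow> int) \<Rightarrow> int \<Rightarrow> strand list" where
  "path_U i P m x =
     (if x \<in> {i, i + 1} then [(0, node_of x, node_of (transp i x))]
      else if m x \<in> {i, i + 1} then
        enter id x @ map deeper (P x) @ [(0, node_of (- m x), node_of (- transp i (m x)))] @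
          map deeper (P (transp i (m x))) @ leave id (m (transp i (m x)))
      else enter id x @ map deeper (P x) @ leave id (m x))"

lemma prime_tangle_T_edges:
  assumes "0 < i" "i < N"
  shows "x \<in> points N \<Longrightarrow> 0 < x \<Longrightarrow>
    {node_of x, node_of (- transp (int i) x)} \<in> prime_tangle N (T_prime i)"
  using assms
  by (auto simp: transp_def node_of_def points_def id_tangle_def doubleton_eq_iff nat_add_distrib
      intro!: exI[of _ "nat x"])

lemma prime_tangle_U_edges:
  assumes "0 < i" "i < N"
  shows "x \<in> points N \<Longrightarrow> 0 < x \<Longrightarrow> x \<notin> {int i, int i + 1} \<Longrightarrow>
      {node_of x, node_of (- x)} \<in> prime_tangle N (U_prime i)"
    and "x \<in> {int i, int i + 1} \<Longrightarrow>
      {node_of x, node_of (transp (int i) x)} \<in> prime_tangle N (U_prime i) \<and>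
      {node_of (- x), node_of (- transp (int i) x)} \<in> prime_tangle N (U_prime i)"
  using assms
  by (auto simp: transp_def node_of_def points_def id_tangle_def doubleton_eq_iff nat_add_distrib insert_commute
      intro!: exI[of _ "nat x"])

text \<open>Both non-identity edges of a prime contain a node of its index column, and the vertical
  edge there is gone. Passing through a prime is therefore the same as changing column in
  it.\<close>

lemma prime_tangle_edge:
  assumes "{a, b} \<in> prime_tangle N p"
  shows "\<bar>int (column a) - int (column b)\<bar> \<le> 1"
    and "column a \<noteq> column b \<longleftrightarrow> Upper (index p) \<in> {a, b} \<or> Lower (index p) \<in> {a, b}"
  using assms by (cases p; auto simp: id_tangle_def doubleton_eq_iff)+

lemma prime_tangle_subset:
  "1 \<le> index p \<Longrightarrow> index p < N \<Longrightarrow> e \<in> prime_tangle N p \<Longrightarrow> e \<subseteq> nodes N"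
  by (cases p) (auto simp: id_tangle_def nodes_def)

lemma deterministic_prime_tangle: "deterministic (prime_tangle N p)"
  unfolding deterministic_def
  by (cases p) (auto simp: id_tangle_def doubleton_eq_iff)

lemma realizes_path_T:
  assumes m: "matching N m" and i: "0 < i" "i < N" and r: "realizes N Xs m P"
  shows "realizes N (prime_tangle N (T_prime i) # Xs) (act_T (int i) m) (path_T (int i) P m)"
  unfolding realizes_def
proof
  let ?i = "int i" and ?X = "prime_tangle N (T_prime i)"
  let ?m = "act_T ?i m" and ?t = "transp ?i" and ?n = "length Xs"
  fix x assume x: "x \<in> points N"
  have m': "matching N ?m" using m i by (intro matching_act_T) auto
  have mx: "?m x \<in> points N" using matchingD(1)[OF m' x] .
  have tx: "?t x \<in> points N" using x i by (simp add: transp_points)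
  have pos: "(0 < y \<longrightarrow> 0 < ?t y) \<and> (y < 0 \<longrightarrow> ?t y = y)" for y using i by (auto simp: transp_def)
  have tm: "?t (?m x) = m (?t x)" by (simp add: act_T_def)
  have "run (?X # Xs) (outer (Suc ?n) x) (path_T ?i P m x) (outer (Suc ?n) (?m x))"
    unfolding path_T_def
  proof (rule run_sandwich)
    show "run (?X # Xs) (outer (Suc ?n) x) (enter ?t x) (deeper (outer ?n (?t x)))"
      by (rule run_enter_leave(1)[OF x]) (use pos prime_tangle_T_edges[OF i x] in auto)
    show "run Xs (outer ?n (?t x)) (P (?t x)) (outer ?n (?t (?m x)))"
      using r tx by (simp add: realizes_def tm)
    show "run (?X # Xs) (deeper (outer ?n (?t (?m x)))) (leave ?t (?m x)) (outer (Suc ?n) (?m x))"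
      by (rule run_enter_leave(2)[OF mx]) (use pos prime_tangle_T_edges[OF i mx] in auto)
    assume "P (?t x) = []"
    then have "?t x < 0 \<or> m (?t x) < 0" by (rule realizes_Nil[OF m r tx])
    then have "\<not> 0 < x \<or> \<not> 0 < ?m x" using pos[of x] pos[of "?m x"] by (auto simp: tm)
    then show "enter ?t x = [] \<or> leave ?t (?m x) = []" by (auto simp: hd_enter_leave)
  qed (simp_all add: hd_enter_leave)
  then show "run (?X # Xs) (outer (length (?X # Xs)) x) (path_T ?i P m x)
      (outer (length (?X # Xs)) (?m x))" by simp
qed

lemma act_U_simps:
  "x \<in> {i, i + 1} \<Longrightarrow> act_U i m x = transp i x"
  "x \<notin> {i, i + 1} \<Longrightarrow> m x \<in> {i, i + 1} \<Longrightarrow> act_U i m x = m (transp i (m x))"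
  "x \<notin> {i, i + 1} \<Longrightarrow> m x \<notin> {i, i + 1} \<Longrightarrow> act_U i m x = m x"
  by (auto simp: act_U_def transp_def)

lemma merge_partner:
  assumes m: "matching N m" and i: "0 < i" "i < int N"
    and x: "x \<in> points N" "x \<notin> {i, i + 1}" "m x \<in> {i, i + 1}"
  shows "transp i (m x) \<in> {i, i + 1}" "transp i (m x) \<in> points N"
    "m (transp i (m x)) \<in> points N" "m (transp i (m x)) \<notin> {i, i + 1}" "m (transp i (m x)) \<noteq> x"
proof -
  let ?y = "transp i (m x)"
  show y: "?y \<in> {i, i + 1}" using x by (auto simp: transp_def)
  then show yp: "?y \<in> points N" using i by (auto simp: points_def)
  show "m ?y \<in> points N" using matchingD(1)[OF m yp] .
  have ne: "?y \<noteq> m x" using x by (auto simp: transp_def)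
  show "m ?y \<noteq> x" using ne matchingD(3)[OF m yp] by auto
  show "m ?y \<notin> {i, i + 1}"
  proof
    assume "m ?y \<in> {i, i + 1}"
    then have "m ?y = m x" using y x(3) ne matchingD(2)[OF m yp] by (auto simp: transp_def)
    then have "?y = x" using matching_eq_iff(1)[OF m yp x(1)] by simp
    then show False using y x by simp
  qed
qed

lemma matching_act_U:
  assumes m: "matching N m" and i: "0 < i" "i < int N"
  shows "matching N (act_U i m)"
  unfolding matching_def
proof
  fix x assume x: "x \<in> points N"
  have p: "i \<in> points N" "i + 1 \<in> points N" using i by (auto simp: points_def)
  show "act_U i m x \<in> points N \<and> act_U i m x \<noteq> x \<and> act_U i m (act_U i m x) = x"
  proof (cases "x \<in> {i, i + 1}")
    case True
    then have "transp i x \<in> {i, i + 1}" "transp i x \<noteq> x" by (auto simp: transp_def)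
    then show ?thesis using True p by (auto simp: act_U_simps(1) simp del: insert_iff)
  next
    case F: False
    show ?thesis
    proof (cases "m x \<in> {i, i + 1}")
      case True
      note y = merge_partner[OF m i x F True]
      have "m (m (transp i (m x))) = transp i (m x)" using matchingD(3)[OF m y(2)] .
      then show ?thesis
        using y F True matchingD(3)[OF m x] by (simp add: act_U_simps(2))
    next
      case False
      then show ?thesis using F x matchingD[OF m x] by (simp add: act_U_simps(3))
    qed
  qed
qed

lemma realizes_path_U:
  assumes m: "matching N m" and i: "0 < i" "i < N" and r: "realizes N Xs m P"
  shows "realizes N (prime_tangle N (U_prime i) # Xs) (act_U (int i) m) (path_U (int i) P m)"
  unfolding realizes_def
proof
  let ?i = "int i" and ?X = "prime_tangle N (U_prime i)"
  let ?m = "act_U ?i m" and ?t = "transp ?i" and ?n = "length Xs" and ?c = "{int i, int i + 1}"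
  have i': "0 < ?i" "?i < int N" using i by simp_all
  fix x assume x: "x \<in> points N"
  have el: "run (?X # Xs) (outer (Suc ?n) y) (enter id y) (deeper (outer ?n y))"
    "run (?X # Xs) (deeper (outer ?n y)) (leave id y) (outer (Suc ?n) y)"
    if "y \<in> points N" "y \<notin> ?c" for y
    using run_enter_leave[of y N id] prime_tangle_U_edges(1)[OF i that(1)] that by auto
  have P: "run Xs (outer ?n y) (P y) (outer ?n (m y))" if "y \<in> points N" for y
    using r that by (simp add: realizes_def)
  have nil: "y < 0 \<or> m y < 0" if "y \<in> points N" "P y = []" for y
    using realizes_Nil[OF m r that] .
  have c: "0 < y" if "y \<in> ?c" for y using that i by auto
  have "run (?X # Xs) (outer (Suc ?n) x) (path_U ?i P m x) (outer (Suc ?n) (?m x))"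
  proof (cases "x \<in> ?c")
    case True
    then have "0 < x" "0 < ?t x" using i by (auto simp: transp_def)
    then have "position 0 (node_of x) = outer (Suc ?n) x" "position 0 (node_of (?t x)) = outer (Suc ?n) (?t x)"
      by (simp_all add: node_of_def)
    then show ?thesis using True prime_tangle_U_edges(2)[OF i True]
      by (simp add: path_U_def act_U_simps(1))
  next
    case F: False
    show ?thesis
    proof (cases "m x \<in> ?c")
      case False
      have mx: "m x \<in> points N" using matchingD(1)[OF m x] .
      have "run (?X # Xs) (outer (Suc ?n) x) (enter id x @ map deeper (P x) @ leave id (m x))
          (outer (Suc ?n) (m x))"
        by (rule run_sandwich[OF el(1)[OF x F] P[OF x] el(2)[OF mx False]])
          (use nil[OF x] in \<open>auto simp: hd_enter_leave\<close>)
      then show ?thesis using F False by (simp add: path_U_def act_U_simps(3))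
    next
      case True
      let ?y = "?t (m x)"
      note y = merge_partner[OF m i' x F True]
      let ?cap = "[(0, node_of (- m x), node_of (- ?y))]"
      have "0 < m x" "0 < ?y" using c True y(1) by blast+
      then have cap: "run (?X # Xs) (deeper (outer ?n (m x))) ?cap (deeper (outer ?n ?y))"
        using prime_tangle_U_edges(2)[OF i True] by (simp add: deeper_outer(1))
      have "run (?X # Xs) (deeper (outer ?n (m x))) (?cap @ map deeper (P ?y) @ leave id (m ?y))
          (outer (Suc ?n) (m ?y))"
        by (rule run_sandwich[OF cap P[OF y(2)] el(2)[OF y(3,4)]])
          (use nil[OF y(2)] c[OF y(1)] in \<open>auto simp: hd_enter_leave\<close>)
      then have "run (?X # Xs) (outer (Suc ?n) x)
          (enter id x @ map deeper (P x) @ ?cap @ map deeper (P ?y) @ leave id (m ?y))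
          (outer (Suc ?n) (m ?y))"
        by (rule run_sandwich[OF el(1)[OF x F] P[OF x]])
          (use nil[OF x] c[OF True] in \<open>auto simp: hd_enter_leave\<close>)
      then show ?thesis using F True by (simp add: path_U_def act_U_simps(2))
    qed
  qed
  then show "run (?X # Xs) (outer (length (?X # Xs)) x) (path_U ?i P m x)
      (outer (length (?X # Xs)) (?m x))" by simp
qed

lemma trace_start:
  assumes "trace Xs x ss y" "x \<noteq> y" "Xs \<noteq> []" and sub: "\<And>X e. X \<in> set Xs \<Longrightarrow> e \<in> X \<Longrightarrow> e \<subseteq> nodes N"
  shows "x \<in> nodes N"
proof -
  have n: "0 < length Xs" using assms(3) by simp
  then have "ss \<noteq> []" using assms(1,2) outer_position_inj[OF n] by (auto simp: trace_iff_run)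
  then obtain k a b t where "ss = (k, a, b) # t" by (metis neq_Nil_conv prod_cases3)
  then have k: "k < length Xs" "position k a = outer_position (length Xs) x" "{a, b} \<in> Xs ! k"
    using assms(1) by (auto simp: trace_iff_run)
  then have "{a, b} \<subseteq> nodes N" by (intro sub) auto
  then show ?thesis using position_outer_position[OF k(1,2)] by simp
qed

lemma realizes_trace:
  assumes m: "matching N m" and r: "realizes N Xs m P" and x: "x \<in> points N"
  shows "node_of x \<noteq> node_of (m x)" "trace Xs (node_of x) (P x) (node_of (m x))"
  using matchingD[OF m x] node_of_inj[OF x, of "m x"] r x
  by (auto simp: trace_iff_run realizes_def)

text \<open>One path from each node is enough: traces are unique, so \<open>compose\<close> has no
  edge besides those exhibited.\<close>

lemma compose_eq_tangle_of:
  assumes m: "matching N m" and r: "realizes N [X, Y] m P"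
    and det: "deterministic X" "deterministic Y"
    and sub: "\<And>e. e \<in> X \<union> Y \<Longrightarrow> e \<subseteq> nodes N"
  shows "compose X Y = tangle_of N m"
proof
  show "tangle_of N m \<subseteq> compose X Y"
    unfolding tangle_of_def compose_def using realizes_trace[OF m r] by blast
  show "compose X Y \<subseteq> tangle_of N m"
  proof
    fix e assume "e \<in> compose X Y"
    then obtain x y ss where e: "e = {x, y}" "x \<noteq> y" "trace [X, Y] x ss y"
      unfolding compose_def by blast
    have "x \<in> nodes N" by (rule trace_start[OF e(3,2)]) (use sub in auto)
    then obtain z where z: "z \<in> points N" "x = node_of z" by (rule node_ofE)
    have "ss = P z \<and> y = node_of (m z)"
      by (rule trace_unique[OF _ e(3,2)]) (use det realizes_trace[OF m r z(1)] z in auto)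
    then show "e \<in> tangle_of N m" using e z by (auto simp: tangle_of_def)
  qed
qed

fun act :: "brauer_prime \<Rightarrow> (int \<Rightarrow> int) \<Rightarrow> int \<Rightarrow> int" where
  "act (T_prime i) m = act_T (int i) m"
| "act (U_prime i) m = act_U (int i) m"

fun prime_path :: "brauer_prime \<Rightarrow> (int \<Rightarrow> strand list) \<Rightarrow> (int \<Rightarrow> int) \<Rightarrow> int \<Rightarrow> strand list" where
  "prime_path (T_prime i) P m = path_T (int i) P m"
| "prime_path (U_prime i) P m = path_U (int i) P m"

lemma realizes_prime_path:
  assumes "matching N m" "1 \<le> index p" "index p < N" "realizes N Xs m P"
  shows "realizes N (prime_tangle N p # Xs) (act p m) (prime_path p P m)"
  using assms realizes_path_T realizes_path_U by (cases p) auto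

lemma matching_act:
  assumes "matching N m" "1 \<le> index p" "index p < N"
  shows "matching N (act p m)"
  using assms by (cases p) (auto intro: matching_act_T matching_act_U)

lemma compose_prime_tangle:
  assumes m: "matching N m" and p: "1 \<le> index p" "index p < N"
  shows "compose (prime_tangle N p) (tangle_of N m) = tangle_of N (act p m)"
  by (rule compose_eq_tangle_of[OF matching_act[OF m p] realizes_prime_path[OF m p realizes_single[OF m]]])
    (use deterministic_prime_tangle deterministic_tangle_of[OF m] prime_tangle_subset[OF p]
      tangle_of_subset[OF m] in blast)+

lemma id_tangle_eq: "id_tangle N = tangle_of N uminus"
proof
  show "id_tangle N \<subseteq> tangle_of N uminus"
  proof
    fix e assume "e \<in> id_tangle N"
    then obtain c where "e = {Upper c, Lower c}" "1 \<le> c" "c \<le> N" by (auto simp: id_tangle_def)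
    then show "e \<in> tangle_of N uminus"
      by (auto simp: tangle_of_def node_of_def points_def intro!: exI[of _ "int c"])
  qed
  show "tangle_of N uminus \<subseteq> id_tangle N"
  proof
    fix e assume "e \<in> tangle_of N uminus"
    then obtain x where "x \<in> points N" "e = {node_of x, node_of (- x)}" by (auto simp: tangle_of_def)
    then show "e \<in> id_tangle N"
      by (auto simp: id_tangle_def node_of_def points_def insert_commute intro!: exI[of _ "nat \<bar>x\<bar>"])
  qed
qed

lemma matching_uminus: "matching N uminus"
  by (auto simp: matching_def points_def)

text \<open>Each step of the descent strips one prime from the top and at least 4 from the weight,
  and only the identity admits no further step.\<close>

lemma short_factorization:
  "matching N m \<Longrightarrow> \<exists>G. factorization N (tangle_of N m) G \<and> 4 * length G \<le> total_weight N m"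
proof (induction "total_weight N m" arbitrary: m rule: less_induct)
  case less
  show ?case
  proof (cases "\<forall>z\<in>points N. m z = - z")
    case True
    then have "tangle_of N m = id_tangle N" unfolding id_tangle_eq by (intro tangle_of_cong) auto
    then show ?thesis by (intro exI[of _ "[]"]) (simp add: factorization_def words_def word_tangle_def)
  next
    case False
    then obtain i m' where i: "0 < i" "i < int N" and m': "matching N m'"
      "total_weight N m' + 4 \<le> total_weight N m"
      and eq: "(\<forall>z\<in>points N. m z = act_T i m' z) \<or> (\<forall>z\<in>points N. m z = act_U i m' z)"
      using descent[OF less.prems] by metis
    obtain p where p: "index p = nat i" "\<And>z. z \<in> points N \<Longrightarrow> m z = act p m' z"
    proof (cases "\<forall>z\<in>points N. m z = act_T i m' z")
      case True
      then show ?thesis using i by (intro that[of "T_prime (nat i)"]) auto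
    next
      case False
      then show ?thesis using i eq by (intro that[of "U_prime (nat i)"]) auto
    qed
    obtain G where G: "factorization N (tangle_of N m') G" "4 * length G \<le> total_weight N m'"
      using less.hyps[OF _ m'(1)] m'(2) by auto
    have ip: "1 \<le> index p" "index p < N" using p i by auto
    have "tangle_of N m = compose (prime_tangle N p) (tangle_of N m')"
      unfolding compose_prime_tangle[OF m'(1) ip] using p(2) by (rule tangle_of_cong)
    then have "factorization N (tangle_of N m) (p # G)"
      using G(1) ip by (auto simp: factorization_def words_def word_tangle_def)
    then show ?thesis using G(2) m'(2) by (intro exI[of _ "p # G"]) auto
  qed
qed


subsection \<open>Counting the primes on a path\<close>

definition moves :: "strand list \<Rightarrow> nat" where
  "moves ss = length (filter (\<lambda>(k, a, b). column a \<noteq> column b) ss)"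

definition T_moves :: "word \<Rightarrow> strand list \<Rightarrow> nat" where
  "T_moves F ss = length (filter (\<lambda>(k, a, b). is_T_prime (F ! k) \<and> column a \<noteq> column b) ss)"

lemma moves_simps [simp]:
  "moves [] = 0" "moves ((k, a, b) # ss) = (if column a \<noteq> column b then 1 else 0) + moves ss"
  "moves (s @ t) = moves s + moves t" "moves (map deeper ss) = moves ss"
proof -
  show "moves (map deeper ss) = moves ss"
    by (induction ss) (auto simp: moves_def)
qed (auto simp: moves_def)

lemma T_moves_simps [simp]:
  "T_moves F [] = 0"
  "T_moves F ((k, a, b) # ss) = (if is_T_prime (F ! k) \<and> column a \<noteq> column b then 1 else 0) + T_moves F ss"
  "T_moves F (s @ t) = T_moves F s + T_moves F t" "T_moves (p # F) (map deeper ss) = T_moves F ss"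
proof -
  show "T_moves (p # F) (map deeper ss) = T_moves F ss"
    by (induction ss) (auto simp: T_moves_def)
qed (auto simp: T_moves_def)

lemma T_moves_le_moves: "T_moves F ss \<le> moves ss"
  by (induction ss) auto

lemma moves_enter_leave_id [simp]:
  "moves (enter id x) = 0" "moves (leave id x) = 0" "T_moves F (enter id x) = 0" "T_moves F (leave id x) = 0"
  by (auto simp: enter_def leave_def)

lemma moves_enter_leave_transp:
  assumes "0 < i"
  shows "moves (enter (transp i) x) = (if x \<in> {i, i + 1} then 1 else 0)"
    "moves (leave (transp i) x) = (if x \<in> {i, i + 1} then 1 else 0)"
    "T_moves (T_prime j # F) (enter (transp i) x) = (if x \<in> {i, i + 1} then 1 else 0)"
    "T_moves (T_prime j # F) (leave (transp i) x) = (if x \<in> {i, i + 1} then 1 else 0)"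
  using assms by (auto simp: enter_def leave_def transp_def)

text \<open>On a whole path this bounds the number of moves below by the size of the edge; on the
  two parts around a strand it refutes coming back.\<close>

lemma run_moves:
  assumes "\<And>k a b. k < length Xs \<Longrightarrow> {a, b} \<in> Xs ! k \<Longrightarrow> \<bar>int (column a) - int (column b)\<bar> \<le> 1"
  shows "run Xs u ss v \<Longrightarrow> \<bar>int (snd v) - int (snd u)\<bar> \<le> int (moves ss)"
proof (induction ss arbitrary: u)
  case (Cons h ss)
  obtain k a b where h: "h = (k, a, b)" by (cases h)
  have sp: "snd (position k c) = column c" for c by (cases c) auto
  have "\<bar>int (column a) - int (column b)\<bar> \<le> 1" "u = position k a" "run Xs (position k b) ss v"
    using Cons.prems assms[of k a b] h by auto
  then show ?case using Cons.IH[of "position k b"] h by (auto simp: sp)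
qed simp

lemma sum_indicator_card: "finite A \<Longrightarrow> (\<Sum>x\<in>A. if x \<in> B then 1 else 0) = card (A \<inter> B)"
  for B :: "'a set"
  by (simp add: sum.inter_restrict[symmetric])

text \<open>Each of the upper nodes \<open>i\<close> and \<open>i + 1\<close> is the start of one
  path and the end of one path, which makes four new moves.\<close>

lemma moves_path_T:
  assumes m: "matching N m" and i: "0 < i" "i < int N"
  shows "(\<Sum>x\<in>points N. moves (path_T i P m x)) \<le> (\<Sum>x\<in>points N. moves (P x)) + 4"
proof -
  let ?m = "act_T i m" and ?t = "transp i"
  let ?f = "\<lambda>x. if x \<in> {i, i + 1} then 1 else 0 :: nat"
  have m': "matching N ?m" using m i by (rule matching_act_T)
  have t: "bij_betw ?t (points N) (points N)"
    by (rule bij_betw_byWitness[of _ ?t]) (use i in \<open>auto simp: transp_points\<close>)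
  have b: "bij_betw ?m (points N) (points N)"
    by (rule bij_betw_byWitness[of _ ?m]) (use matchingD[OF m'] in auto)
  have "(\<Sum>x\<in>points N. ?f x) = card (points N \<inter> {i, i + 1})" by (rule sum_indicator_card) simp
  also have "\<dots> \<le> card {i, i + 1}" by (rule card_mono) auto
  finally have c: "(\<Sum>x\<in>points N. ?f x) \<le> 2" by simp
  have "(\<Sum>x\<in>points N. moves (path_T i P m x)) =
      (\<Sum>x\<in>points N. ?f x) + (\<Sum>x\<in>points N. moves (P (?t x))) + (\<Sum>x\<in>points N. ?f (?m x))"
    using i by (simp only: path_T_def moves_simps moves_enter_leave_transp sum.distrib)
  also have "(\<Sum>x\<in>points N. moves (P (?t x))) = (\<Sum>x\<in>points N. moves (P x))"
    by (rule sum.reindex_bij_betw[OF t])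
  also have "(\<Sum>x\<in>points N. ?f (?m x)) = (\<Sum>x\<in>points N. ?f x)"
    by (rule sum.reindex_bij_betw[OF b])
  finally show ?thesis using c by simp
qed

text \<open>The old paths from \<open>i\<close> and \<open>i + 1\<close> reappear as second halves
  of the joined paths. New are one move for each direction of the upper edge of the prime and one
  for each direction of the lower edge. If \<open>i\<close> and \<open>i + 1\<close> were matched,
  their paths vanish in a closed loop, hence only an inequality.\<close>

lemma moves_path_U:
  assumes m: "matching N m" and i: "0 < i" "i < int N"
  shows "(\<Sum>x\<in>points N. moves (path_U i P m x)) \<le> (\<Sum>x\<in>points N. moves (P x)) + 4"
proof -
  let ?c = "{i, i + 1}" and ?t = "transp i"
  let ?A = "{x \<in> points N - ?c. m x \<in> ?c}"
  let ?g = "\<lambda>x. ?t (m x)"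
  have c: "?c \<subseteq> points N" using i by (auto simp: points_def)
  have inj: "inj_on ?g ?A"
    by (rule inj_onI) (use matching_eq_iff(1)[OF m] in auto)
  have im: "?g ` ?A \<subseteq> ?c" using i by (auto simp: transp_def)
  have "card ?A = card (?g ` ?A)" using inj by (simp add: card_image)
  also have "\<dots> \<le> card ?c" using im by (rule card_mono[rotated]) simp
  finally have card: "card ?A \<le> 2" by simp
  have "(\<Sum>x\<in>?A. moves (P (?g x))) = (\<Sum>y\<in>?g ` ?A. moves (P y))"
    using inj by (simp add: sum.reindex)
  also have "\<dots> \<le> (\<Sum>y\<in>?c. moves (P y))" by (rule sum_mono2) (use im in auto)
  finally have merged: "(\<Sum>x\<in>?A. moves (P (?g x))) \<le> (\<Sum>y\<in>?c. moves (P y))" .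
  have caps: "moves (path_U i P m x) \<le> 1" if "x \<in> ?c" for x using that by (simp add: path_U_def)
  have rest: "moves (path_U i P m x) \<le>
      moves (P x) + (if x \<in> ?A then 1 + moves (P (?g x)) else 0)" if "x \<in> points N - ?c" for x
    using that by (auto simp: path_U_def)
  have "(\<Sum>x\<in>points N - ?c. moves (path_U i P m x)) \<le>
      (\<Sum>x\<in>points N - ?c. moves (P x) + (if x \<in> ?A then 1 + moves (P (?g x)) else 0))"
    using rest by (rule sum_mono)
  also have "\<dots> = (\<Sum>x\<in>points N - ?c. moves (P x)) +
      (\<Sum>x\<in>points N - ?c. if x \<in> ?A then 1 + moves (P (?g x)) else 0)"
    by (rule sum.distrib)
  also have "(\<Sum>x\<in>points N - ?c. if x \<in> ?A then 1 + moves (P (?g x)) else 0) =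
      (\<Sum>x\<in>?A. 1 + moves (P (?g x)))"
    by (rule sum.mono_neutral_cong_right) auto
  also have "(\<Sum>x\<in>points N - ?c. moves (P x)) + (\<Sum>x\<in>?A. 1 + moves (P (?g x))) \<le> (\<Sum>x\<in>points N - ?c. moves (P x)) + (2 + (\<Sum>y\<in>?c. moves (P y)))"
    using merged card by (simp only: sum.distrib) simp
  also have "\<dots> = (\<Sum>x\<in>points N. moves (P x)) + 2"
    using sum.subset_diff[OF c finite_points, of "\<lambda>x. moves (P x)"] by simp
  finally have "(\<Sum>x\<in>points N - ?c. moves (path_U i P m x)) \<le> (\<Sum>x\<in>points N. moves (P x)) + 2" .
  moreover have "(\<Sum>x\<in>?c. moves (path_U i P m x)) \<le> (\<Sum>x\<in>?c. 1)" using caps by (rule sum_mono)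
  then have "(\<Sum>x\<in>?c. moves (path_U i P m x)) \<le> 2" by simp
  ultimately show ?thesis
    using sum.subset_diff[OF c finite_points, of "\<lambda>x. moves (path_U i P m x)"] by simp
qed

text \<open>Only an edge ending at upper node \<open>i\<close> or \<open>i + 1\<close> can gain a
  crossing, at most one, and it pays for it with a move in the new prime.\<close>

lemma T_moves_path_T:
  assumes m: "matching N m" and i: "0 < i" "i < N"
    and P: "\<And>x. x \<in> points N \<Longrightarrow> crossings N m x \<le> T_moves F (P x)" and x: "x \<in> points N"
  shows "crossings N (act_T (int i) m) x \<le> T_moves (T_prime i # F) (path_T (int i) P m x)"
proof -
  let ?i = "int i"
  let ?m = "act_T ?i m" and ?t = "transp ?i" and ?c = "{int i, int i + 1}"
  have i': "0 < ?i" "?i < int N" using i by auto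
  have m': "matching N ?m" using m i' by (rule matching_act_T)
  have tx: "?t x \<in> points N" using x i' by (simp add: transp_points)
  have ti: "?t y \<in> ?c \<longleftrightarrow> y \<in> ?c" for y by (auto simp: transp_def)
  have tm: "?t (?m x) = m (?t x)" by (simp add: act_T_def)
  have eq: "T_moves (T_prime i # F) (path_T ?i P m x) =
      (if x \<in> ?c then 1 else 0) + T_moves F (P (?t x)) + (if ?m x \<in> ?c then 1 else 0)"
    using i' by (simp only: path_T_def T_moves_simps moves_enter_leave_transp)
  have "crossings N ?m x \<le> crossings N m (?t x) + (if x \<in> ?c \<or> ?m x \<in> ?c then 1 else 0)"
  proof (cases "x \<in> ?c")
    case True
    then have "crossings N ?m (?t (?t x)) \<le> crossings N m (?t x) + 1"
      using ti by (intro crossings_act_T_touched[OF m i']) blast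
    then show ?thesis using True by simp
  next
    case F: False
    show ?thesis
    proof (cases "?m x \<in> ?c")
      case True
      then have "m (?t x) \<in> ?c" using ti[of "?m x"] tm by simp
      then have "crossings N ?m (?t (m (?t x))) \<le> crossings N m (m (?t x)) + 1"
        by (rule crossings_act_T_touched[OF m i'])
      then have "crossings N ?m (?m x) \<le> crossings N m (?t x) + 1"
        using crossings_partner[OF m tx] by (simp add: act_T_def)
      then show ?thesis using True crossings_partner[OF m' x] by simp
    next
      case False
      then have "{?t x, m (?t x)} \<inter> ?c = {}" using F ti[of x] ti[of "?m x"] tm by auto
      then have "crossings N ?m (?t (?t x)) \<le> crossings N m (?t x)"
        by (rule crossings_act_T_untouched[OF m i' tx])
      then show ?thesis by simp
    qed
  qed
  then show ?thesis using P[OF tx] unfolding eq by (auto split: if_splits)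
qed

section \<open>Crossing numbers under a \<open>U\<close>-prime on top\<close>

lemma between_iff: "z \<noteq> x \<Longrightarrow> z \<noteq> y \<Longrightarrow> between x z y \<longleftrightarrow> (z < x) \<noteq> (z < y)"
  by (auto simp: between_def)

lemma between_same: "\<not> between x x y" "\<not> between x y y"
  by (auto simp: between_def)

text \<open>\<open>between\<close> is an exclusive or of two comparisons, and the neighbours
  \<open>a\<close> and \<open>b\<close> compare alike with all other nodes. So crossing the joined
  edge is the exclusive or of crossing its two pieces, and it implies crossing one of them.\<close>

lemma crossings_act_U_merged:
  assumes m: "matching N m" and i: "0 < i" "i < int N"
    and x: "x \<in> points N" "x \<notin> {i, i + 1}" "m x \<in> {i, i + 1}"
  shows "crossings N (act_U i m) x \<le> crossings N m x + crossings N m (transp i (m x))"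
proof -
  let ?m = "act_U i m"
  define a b y where "a = m x" and "b = transp i a" and "y = m b"
  note mp = merge_partner[OF m i x]
  have ab: "{a, b} = {i, i + 1}" "a \<noteq> b" using x(3) by (auto simp: a_def b_def transp_def)
  have y: "y \<in> points N" "y \<notin> {i, i + 1}" "y \<noteq> x"
    using mp by (simp_all add: a_def b_def y_def)
  have bp: "b \<in> points N" using mp by (simp add: a_def b_def)
  have my: "?m x = y" using x by (simp add: act_U_simps(2) a_def b_def y_def)
  have m': "matching N ?m" using m i by (rule matching_act_U)
  have "crossers N ?m x \<subseteq> crossers N m x \<union> crossers N m b"
  proof
    fix z assume z: "z \<in> crossers N ?m x"
    have zp: "z \<in> points N" using z by (simp add: crossers_def)
    have zc: "between x z y \<noteq> between x (?m z) y" using z my by (simp add: crossers_def)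
    have adj: "(i < w) = (i + 1 < w)" if "w \<notin> {i, i + 1}" for w using that by auto
    have "between x i y = between x (i + 1) y"
      using x y by (auto simp: between_iff adj)
    then have zi: "z \<notin> {i, i + 1}" using zc by (auto simp: act_U_def split: if_splits)
    have myy: "?m y = x" using matchingD(3)[OF m' x(1)] my by simp
    have zxy: "z \<noteq> x" "z \<noteq> y" using zc my myy by (auto simp: between_same)
    have mz: "m z \<noteq> a" "m z \<noteq> b"
      using zxy matching_eq_iff(1)[OF m zp x(1)] matchingD(3)[OF m zp] by (auto simp: a_def y_def)
    then have mzi: "m z \<notin> {i, i + 1}" using ab by auto
    then have mz': "?m z = m z" using zi by (simp add: act_U_simps(3))
    have "b \<in> {i, i + 1}" using ab by blast
    then have mzxy: "m z \<noteq> x" "m z \<noteq> y"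
      using zi x(3) matching_eq_iff(2)[OF m zp x(1)] matching_eq_iff(1)[OF m zp bp]
      unfolding y_def by metis+
    have side: "(w < a) = (w < b)" if "w \<notin> {i, i + 1}" for w
      using that ab by (auto simp: doubleton_eq_iff)
    have ne: "z \<noteq> a" "z \<noteq> b" using zi ab by auto
    have xor: "(p \<noteq> q) \<noteq> (p' \<noteq> q') \<Longrightarrow> r = s \<Longrightarrow> r' = s' \<Longrightarrow>
        (p \<noteq> r) \<noteq> (p' \<noteq> r') \<or> (s \<noteq> q) \<noteq> (s' \<noteq> q')" for p q r s p' q' r' s' :: bool
      by blast
    have "between x z a \<noteq> between x (m z) a \<or> between b z y \<noteq> between b (m z) y"
      using xor[OF _ side[OF zi] side[OF mzi]] zc unfolding mz' between_iff[OF zxy] between_iff[OF mzxy]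
        between_iff[OF zxy(1) ne(1)] between_iff[OF mzxy(1) mz(1)]
        between_iff[OF ne(2) zxy(2)] between_iff[OF mz(2) mzxy(2)] .
    then show "z \<in> crossers N m x \<union> crossers N m b"
      using zp by (auto simp: crossers_def a_def y_def)
  qed
  then have "card (crossers N ?m x) \<le> card (crossers N m x \<union> crossers N m b)" by (intro card_mono) auto
  also have "\<dots> \<le> card (crossers N m x) + card (crossers N m b)" by (rule card_Un_le)
  finally show ?thesis by (simp add: card_crossers m m' a_def b_def)
qed

lemma crossings_act_U_untouched:
  assumes m: "matching N m" and i: "0 < i" "i < int N"
    and x: "x \<in> points N" "x \<notin> {i, i + 1}" "m x \<notin> {i, i + 1}"
  shows "crossings N (act_U i m) x \<le> crossings N m x"
proof -
  let ?m = "act_U i m" and ?b = "\<lambda>z. between x z (m x)"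
  \<comment> \<open>A joined edge crosses the edge at \<open>x\<close> only if one of its pieces
    did. If the piece at the end \<open>z\<close> did not, the end of the other piece in column
    \<open>i\<close> or \<open>i + 1\<close> stands in for \<open>z\<close>, and \<phi> sends it
    there. Covering the new crossers suffices, so \<phi> may be non-injective.\<close>
  define \<phi> where "\<phi> z = (if z \<in> {i, i + 1} then m (transp i z) else z)" for z
  have p: "i \<in> points N" "i + 1 \<in> points N" using i by (auto simp: points_def)
  have m': "matching N ?m" using m i by (rule matching_act_U)
  have mx: "?m x = m x" using x by (simp add: act_U_simps(3))
  have adj: "(i < w) = (i + 1 < w)" if "w \<notin> {i, i + 1}" for w using that by auto
  have bi: "?b i = ?b (i + 1)" using x by (auto simp: between_iff adj)
  have "crossers N ?m x \<subseteq> \<phi> ` crossers N m x"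
  proof
    fix z assume z: "z \<in> crossers N ?m x"
    have zp: "z \<in> points N" using z by (simp add: crossers_def)
    have zc: "?b z \<noteq> ?b (?m z)" using z mx by (simp add: crossers_def)
    have zi: "z \<notin> {i, i + 1}" using zc bi by (auto simp: act_U_def split: if_splits)
    show "z \<in> \<phi> ` crossers N m x"
    proof (cases "m z \<in> {i, i + 1}")
      case False
      then have "z \<in> crossers N m x" using zp zc zi by (simp add: crossers_def act_U_simps(3))
      moreover have "\<phi> z = z" using zi by (simp add: \<phi>_def)
      ultimately show ?thesis by force
    next
      case True
      let ?w = "transp i (m z)"
      note w = merge_partner[OF m i zp zi True]
      have mz: "?m z = m ?w" using zi True by (simp add: act_U_simps(2))
      have bw: "?b ?w = ?b (m z)" using w(1) True bi by auto
      show ?thesis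
      proof (cases "?b z = ?b (m z)")
        case True
        then have "?w \<in> crossers N m x" using zc bw mz w(2) by (auto simp: crossers_def)
        moreover have "\<phi> ?w = z" using w(1) matchingD(3)[OF m zp] by (simp add: \<phi>_def)
        ultimately show ?thesis by force
      next
        case False
        then have "z \<in> crossers N m x" using zp by (simp add: crossers_def)
        moreover have "\<phi> z = z" using zi by (simp add: \<phi>_def)
        ultimately show ?thesis by force
      qed
    qed
  qed
  then have "card (crossers N ?m x) \<le> card (crossers N m x)" by (rule surj_card_le[rotated]) simp
  then show ?thesis by (simp add: card_crossers m m')
qed

lemma T_moves_path_U:
  assumes m: "matching N m" and i: "0 < i" "i < N"
    and P: "\<And>x. x \<in> points N \<Longrightarrow> crossings N m x \<le> T_moves F (P x)" and x: "x \<in> points N"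
  shows "crossings N (act_U (int i) m) x \<le> T_moves (U_prime i # F) (path_U (int i) P m x)"
proof -
  let ?i = "int i"
  let ?m = "act_U ?i m" and ?c = "{int i, int i + 1}"
  have i': "0 < ?i" "?i < int N" using i by auto
  show ?thesis
  proof (cases "x \<in> ?c")
    case True
    have "{x, ?m x} = ?c" using True by (auto simp: act_U_def)
    then have "\<not> between x z (?m x)" for z by (auto simp: between_def doubleton_eq_iff)
    then show ?thesis by (simp add: crossings_def)
  next
    case F: False
    show ?thesis
    proof (cases "m x \<in> ?c")
      case True
      note y = merge_partner[OF m i' x F True]
      show ?thesis
        using crossings_act_U_merged[OF m i' x F True] P[OF x] P[OF y(2)] F True
        by (simp add: path_U_def del: insert_iff)
    next
      case False
      show ?thesis
        using crossings_act_U_untouched[OF m i' x F False] P[OF x] F False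
        by (simp add: path_U_def del: insert_iff)
    qed
  qed
qed

text \<open>The upper bound concerns the moves of all paths together, the lower bound the moves of
  each single path in \<open>T\<close>-primes; \<open>minimal_paths\<close> plays them off against
  each other.\<close>

lemma word_paths:
  assumes "F \<in> words N"
  shows "\<exists>m P. matching N m \<and> word_tangle N F = tangle_of N m \<and>
    realizes N (map (prime_tangle N) F) m P \<and> (\<Sum>x\<in>points N. moves (P x)) \<le> 4 * length F \<and>
    (\<forall>x\<in>points N. crossings N m x \<le> T_moves F (P x))"
  using assms
proof (induction F)
  case Nil
  have "realizes N [] uminus (\<lambda>x. [])"
    by (auto simp: realizes_def node_of_def)
  moreover have "crossings N uminus x = 0" for x
    by (auto simp: crossings_def between_def)
  ultimately show ?case
    by (intro exI[of _ uminus] exI[of _ "\<lambda>x. []"])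
      (simp add: matching_uminus word_tangle_def id_tangle_eq)
next
  case (Cons p F)
  have p: "1 \<le> index p" "index p < N" and F: "F \<in> words N" using Cons.prems by (auto simp: words_def)
  obtain m P where m: "matching N m" and w: "word_tangle N F = tangle_of N m"
    and r: "realizes N (map (prime_tangle N) F) m P"
    and s: "(\<Sum>x\<in>points N. moves (P x)) \<le> 4 * length F"
    and c: "\<forall>x\<in>points N. crossings N m x \<le> T_moves F (P x)"
    using Cons.IH[OF F] by metis
  have "word_tangle N (p # F) = tangle_of N (act p m)"
    using compose_prime_tangle[OF m p] w by (simp add: word_tangle_def)
  moreover have "(\<Sum>x\<in>points N. moves (prime_path p P m x)) \<le> (\<Sum>x\<in>points N. moves (P x)) + 4"
    using p moves_path_T[OF m, of _ P] moves_path_U[OF m, of _ P] by (cases p) auto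
  moreover have "crossings N (act p m) x \<le> T_moves (p # F) (prime_path p P m x)" if "x \<in> points N" for x
    using p c T_moves_path_T[OF m _ _ _ that, of _ F P] T_moves_path_U[OF m _ _ _ that, of _ F P]
    by (cases p) auto
  ultimately show ?case
    using s matching_act[OF m p] realizes_prime_path[OF m p r]
    by (intro exI[of _ "act p m"] exI[of _ "prime_path p P m"]) auto
qed

text \<open>Each path makes at least \<open>weight\<close> moves, whereas all moves together are at
  most \<open>4 * length F\<close>, which minimality and \<open>short_factorization\<close> bound by
  \<open>total_weight\<close>. Termwise ordered families with equal sums agree everywhere.\<close>

lemma minimal_paths:
  assumes "minimal_factorization N X F"
  obtains m P where "matching N m" "X = tangle_of N m" "realizes N (map (prime_tangle N) F) m P"
    "\<And>x. x \<in> points N \<Longrightarrow> crossings N m x \<le> T_moves F (P x)"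
    "\<And>x. x \<in> points N \<Longrightarrow> moves (P x) = weight N m x"
proof -
  have F: "F \<in> words N" "word_tangle N F = X" and min: "\<And>G. factorization N X G \<Longrightarrow> length F \<le> length G"
    using assms by (auto simp: minimal_factorization_def factorization_def)
  obtain m P where m: "matching N m" and w: "word_tangle N F = tangle_of N m"
    and r: "realizes N (map (prime_tangle N) F) m P"
    and s: "(\<Sum>x\<in>points N. moves (P x)) \<le> 4 * length F"
    and c: "\<forall>x\<in>points N. crossings N m x \<le> T_moves F (P x)"
    using word_paths[OF F(1)] by metis
  obtain G where "factorization N X G" "4 * length G \<le> total_weight N m"
    using short_factorization[OF m] w F(2) by auto
  then have tw: "4 * length F \<le> total_weight N m" using min by fastforce
  have le: "weight N m x \<le> moves (P x)" if x: "x \<in> points N" for x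
  proof -
    have "\<bar>int (snd (outer (length F) (m x))) - int (snd (outer (length F) x))\<bar> \<le> int (moves (P x))"
      by (rule run_moves[of "map (prime_tangle N) F"])
        (use r x prime_tangle_edge(1) in \<open>auto simp: realizes_def\<close>)
    moreover have "int (snd (outer n y)) = \<bar>y\<bar>" for n y by (simp add: node_of_def)
    ultimately have "width m x \<le> moves (P x)" by (simp add: width_def abs_minus_commute)
    moreover have "crossings N m x \<le> moves (P x)" using c x T_moves_le_moves order_trans by blast
    ultimately show ?thesis by (simp add: weight_def)
  qed
  have sum_eq: "(\<Sum>x\<in>points N. weight N m x) = (\<Sum>x\<in>points N. moves (P x))"
    using sum_mono[of "points N" "weight N m" "\<lambda>x. moves (P x)"] le s tw
    by (simp add: total_weight_def)
  have "moves (P x) = weight N m x" if x: "x \<in> points N" for x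
  proof (rule ccontr)
    assume "moves (P x) \<noteq> weight N m x"
    then have "weight N m x < moves (P x)" using le[OF x] by simp
    then have "(\<Sum>x\<in>points N. weight N m x) < (\<Sum>x\<in>points N. moves (P x))"
      using le x by (intro sum_strict_mono_ex1) auto
    then show False using sum_eq by simp
  qed
  then show thesis using that m w F(2) r c by metis
qed

theorem mainTheorem4:
  fixes N :: nat and X :: tangle and F :: word and e :: edge
  assumes "assumption1"
    and "X \<in> brauer N"
    and "minimal_factorization N X F"
    and "e \<in> X"
  shows "(num_U N F e > 0 \<longrightarrow> \<not> comes_back N F e \<and> num_T N F e < edge_size e) \<and>
         (num_T N F e \<ge> edge_size e \<longrightarrow> num_U N F e = 0)"
proof -
  let ?Xs = "map (prime_tangle N) F"
  obtain m P where m: "matching N m" and X: "X = tangle_of N m" and r: "realizes N ?Xs m P"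
    and c: "\<And>x. x \<in> points N \<Longrightarrow> crossings N m x \<le> T_moves F (P x)"
    and mv: "\<And>x. x \<in> points N \<Longrightarrow> moves (P x) = weight N m x"
    using minimal_paths[OF assms(3)] by metis
  have det: "\<forall>X\<in>set ?Xs. deterministic X" using deterministic_prime_tangle by auto
  obtain x0 where x0: "x0 \<in> points N" "e = {node_of x0, node_of (m x0)}"
    using assms(4) X by (auto simp: tangle_of_def)
  \<comment> \<open>\<open>passes_through\<close> and \<open>comes_back_at\<close> admit traces from
    either end; by uniqueness each of them is one of the paths \<open>P z\<close>.\<close>
  have et: "\<exists>z\<in>points N. x = node_of z \<and> e = {node_of z, node_of (m z)} \<and> ss = P z"
    if tr: "edge_trace N F e x ss" for x ss
  proof -
    obtain y where y: "x \<noteq> y" "e = {x, y}" "trace ?Xs x ss y"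
      using tr unfolding edge_trace_def by blast
    obtain z where z: "z \<in> points N" "x = node_of z" "y = node_of (m z)"
    proof (cases "x = node_of x0")
      case True
      then show ?thesis using that[of x0] x0 y by (auto simp: doubleton_eq_iff)
    next
      case False
      then show ?thesis
        using that[of "m x0"] x0 y matchingD[OF m x0(1)] by (auto simp: doubleton_eq_iff)
    qed
    have "x \<noteq> node_of (m z)" "trace ?Xs x (P z) (node_of (m z))"
      using realizes_trace[OF m r z(1)] z(2) by simp_all
    then have "ss = P z" using trace_unique[OF det y(3,1)] by blast
    then show ?thesis using z y by auto
  qed
  have main: "\<not> comes_back N F e \<and> num_T N F e < edge_size e" if U: "num_U N F e > 0"
  proof -
    let ?K = "{k. k < length F \<and> is_U_prime (F ! k) \<and> passes_through N F e k}"
    have "?K \<noteq> {}" using U unfolding num_U_def by (metis card.empty less_irrefl)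
    then obtain k0 x1 ss a0 b0 where k0: "k0 < length F" "is_U_prime (F ! k0)"
      "edge_trace N F e x1 ss" "(k0, a0, b0) \<in> set ss"
      "Upper (index (F ! k0)) \<in> {a0, b0} \<or> Lower (index (F ! k0)) \<in> {a0, b0}"
      by (auto simp: passes_through_def)
    obtain z where z: "z \<in> points N" "e = {node_of z, node_of (m z)}" "ss = P z"
      using et[OF k0(3)] by auto
    have mz: "m z \<in> points N" using matchingD(1)[OF m z(1)] .
    have valid: "k < length F \<and> {a, b} \<in> prime_tangle N (F ! k)"
      if "w \<in> points N" "(k, a, b) \<in> set (P w)" for w k a b
    proof -
      have "run ?Xs (outer (length ?Xs) w) (P w) (outer (length ?Xs) (m w))"
        using r that(1) unfolding realizes_def by blast
      then show ?thesis using that(2) unfolding run_iff by (auto dest!: bspec)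
    qed
    have lt: "T_moves F (P z) < moves (P z)"
    proof -
      have "column a0 \<noteq> column b0"
        using prime_tangle_edge(2)[of a0 b0 N "F ! k0"] valid[OF z(1)] k0 z by blast
      moreover have "\<not> is_T_prime (F ! k0)" using k0(2) by (cases "F ! k0") auto
      moreover obtain s t where "P z = s @ (k0, a0, b0) # t" using k0(4) z(3) by (meson split_list)
      ultimately show ?thesis
        using T_moves_le_moves[of F s] T_moves_le_moves[of F t] by simp
    qed
    have wz: "moves (P z) = width m z"
      using lt c[OF z(1)] mv[OF z(1)] by (simp add: weight_def max_def split: if_splits)
    have wmz: "moves (P (m z)) = width m (m z)"
      using wz mv[OF z(1)] mv[OF mz] weight_partner[OF m z(1)] width_partner[OF m z(1)] by simp
    have ends: "w = z \<or> w = m z" if "w \<in> points N" "e = {node_of w, node_of (m w)}" for w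
      using that z node_of_inj[OF that(1) z(1)] node_of_inj[OF that(1) mz]
      by (auto simp: doubleton_eq_iff)
    have "\<not> comes_back N F e"
    proof
      assume "comes_back N F e"
      then obtain k x ss' a b where cb: "edge_trace N F e x ss'" "(k, a, b) \<in> set ss'"
        "\<bar>int (column b) - int (column x)\<bar> < \<bar>int (column a) - int (column x)\<bar>"
        by (auto simp: comes_back_def comes_back_at_def)
      obtain w where w: "w \<in> points N" "x = node_of w" "e = {node_of w, node_of (m w)}" "ss' = P w"
        using et[OF cb(1)] by auto
      have ww: "moves (P w) = width m w" using ends[OF w(1,3)] wz wmz by auto
      obtain s t where st: "P w = s @ (k, a, b) # t" using cb(2) w(4) by (meson split_list)
      have "run ?Xs (outer (length F) w) (P w) (outer (length F) (m w))"
        using r w(1) by (simp add: realizes_def)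
      then obtain v where v: "run ?Xs (outer (length F) w) s v" "run ?Xs v ((k, a, b) # t) (outer (length F) (m w))"
        unfolding st using run_appendD by blast
      have len: "\<bar>int (column a) - int (column b)\<bar> \<le> 1" if "k < length ?Xs" "{a, b} \<in> ?Xs ! k" for k a b
        using that prime_tangle_edge(1) by auto
      have sp: "snd (position k y) = column y" for k y by (cases y) auto
      have so: "int (snd (outer n y)) = \<bar>y\<bar>" for n y by (simp add: node_of_def)
      have 1: "\<bar>int (column a) - \<bar>w\<bar>\<bar> \<le> int (moves s)"
        using run_moves[OF len v(1)] v(2) by (auto simp: sp so)
      have "run ?Xs (position k b) t (outer (length F) (m w))" using v(2) by simp
      then have 2: "\<bar>\<bar>m w\<bar> - int (column b)\<bar> \<le> int (moves t)"
        using run_moves[OF len] by (fastforce simp: sp so)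
      \<comment> \<open>Coming back makes \<open>b\<close> nearer to the start than
        \<open>a\<close>, so the size is at most the distance from start to \<open>b\<close> plus
        that from \<open>b\<close> to the end, hence less than \<open>moves s + moves t\<close>,
        contradicting \<open>ww\<close>.\<close>
      have "int (width m w) = \<bar>\<bar>w\<bar> - \<bar>m w\<bar>\<bar>" by (simp add: width_def)
      moreover have "moves s + moves t \<le> moves (P w)" unfolding st by simp
      moreover have "\<bar>int (column b) - \<bar>w\<bar>\<bar> < \<bar>int (column a) - \<bar>w\<bar>\<bar>"
        using cb(3) w(2) by simp
      ultimately show False using 1 2 ww by linarith
    qed
    moreover have "num_T N F e \<le> T_moves F (P z)"
    proof -
      let ?L = "filter (\<lambda>(k, a, b). is_T_prime (F ! k) \<and> column a \<noteq> column b) (P z)"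
      \<comment> \<open>\<open>num_T\<close> collects primes over the traces from both ends; they
        visit the same primes, since one is the reverse of the other.\<close>
      have rev: "P (m z) = reverse_strands (P z)"
      proof -
        note tz = realizes_trace[OF m r z(1)] and tmz = realizes_trace[OF m r mz]
        have "trace ?Xs (node_of (m z)) (reverse_strands (P z)) (node_of z)"
          using tz(2) by (simp add: trace_iff_run run_reverse)
        then show ?thesis
          using trace_unique[OF det tmz(2,1)] tz(1) by metis
      qed
      \<comment> \<open>A prime met on both of its edges is one position but two moves, so the count
        of primes is only bounded by the count of moves.\<close>
      have "{k. k < length F \<and> is_T_prime (F ! k) \<and> passes_through N F e k} \<subseteq> fst ` set ?L"
      proof
        fix k assume "k \<in> {k. k < length F \<and> is_T_prime (F ! k) \<and> passes_through N F e k}"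
        then obtain x ss' a b where k: "is_T_prime (F ! k)" "edge_trace N F e x ss'" "(k, a, b) \<in> set ss'"
          "Upper (index (F ! k)) \<in> {a, b} \<or> Lower (index (F ! k)) \<in> {a, b}"
          by (auto simp: passes_through_def)
        obtain w where w: "w \<in> points N" "e = {node_of w, node_of (m w)}" "ss' = P w"
          using et[OF k(2)] by auto
        have ne: "column a \<noteq> column b"
          using prime_tangle_edge(2)[of a b N "F ! k"] valid[OF w(1)] k w by blast
        have "(k, a, b) \<in> set (P z) \<or> (k, b, a) \<in> set (P z)"
          using ends[OF w(1,2)] k(3) w(3) rev by (auto simp: reverse_strands_def)
        then show "k \<in> fst ` set ?L" using ne k(1) by force
      qed
      then have "num_T N F e \<le> card (fst ` set ?L)" unfolding num_T_def by (rule card_mono[rotated]) simp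
      also have "\<dots> \<le> card (set ?L)" by (rule card_image_le) simp
      also have "\<dots> \<le> T_moves F (P z)" unfolding T_moves_def by (rule card_length)
      finally show ?thesis .
    qed
    moreover have "edge_size e = width m z"
      unfolding z(2) edge_size_pair by (simp add: width_def)
    ultimately show ?thesis using lt wz by simp
  qed
  then show ?thesis by (auto simp: not_less[symmetric])
qed


end
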